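(* Let $K$ be a field of characteristic $0$, let $k\ge2$, let $f(z)\in K[[z]]$ be $k$-Mahler, and let $\mathfrak d(z)$ be the $k$-Mahler denominator of $f(z)$. Then $f(z)$ is $k$-regular if and only if every non-zero root of $\mathfrak d(z)$ in an algebraic closure $\overline K$ is a root of unity whose order is not coprime to $k$.
   Context: $f\in K[[z]]$ is $k$-Mahler if there are $d\ge0$ and $p_0,\dots,p_d\in K[z]$ with $p_0p_d\ne0$ and $\sum_{i=0}^dp_i(z)f(z^{k^i})=0$. The $k$-Mahler denominator is the generator, with lowest non-zero coefficient $1$, of the ideal $\{p\in K[z]: p(z)f(z)\in\sum_{i\ge1}K[z]f(z^{k^i})\}$. $f=\sum a_nz^n$ is $k$-regular if the $k$-kernel $\{(a_{k^en+r})_{n\ge0}: e\ge0, 0\le r<k^e\}$ spans a finite-dimensional $K$-vector subspace of the space of $K$-valued sequences. *)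

theory Defs
  imports
    "HOL-Computational_Algebra.Computational_Algebra"
    "HOL-Library.Function_Algebras"
    "HOL-Algebra.Algebraic_Closure_Type"
begin

definition is_mahler :: "nat \<Rightarrow> 'a::field fps \<Rightarrow> bool" where
  "is_mahler k f \<longleftrightarrow>
     (\<exists>(d::nat) (p :: nat \<Rightarrow> 'a poly). p 0 * p d \<noteq> 0 \<and>
        (\<Sum>i=0..d. fps_of_poly (p i) * (f oo fps_X ^ (k ^ i))) = 0)"

text \<open>
  The infinite sum of submodules over \<open>i \<ge> 1\<close> consists of the finite sums, hence the bound \<open>n\<close>.
\<close>
definition mahler_ideal :: "nat \<Rightarrow> 'a::field fps \<Rightarrow> 'a poly set" where
  "mahler_ideal k f =
     {p. \<exists>(n::nat) (q :: nat \<Rightarrow> 'a poly).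
           fps_of_poly p * f = (\<Sum>i=1..n. fps_of_poly (q i) * (f oo fps_X ^ (k ^ i)))}"

text \<open>For the zero polynomial the value is unspecified.\<close>
definition lowest_coeff :: "'a::zero poly \<Rightarrow> 'a" where
  "lowest_coeff p = coeff p (LEAST n. coeff p n \<noteq> 0)"

text \<open>
  The principal ideal generated by \<open>d\<close> is the set of all multiples of \<open>d\<close>.
  Existence and uniqueness for Mahler series are shown in \<open>mahler_denominator_ex1\<close> below; for series
  that are not Mahler the ideal is zero and the value is unspecified.
\<close>
definition mahler_denominator :: "nat \<Rightarrow> 'a::field fps \<Rightarrow> 'a poly" where
  "mahler_denominator k f =
     (THE d. mahler_ideal k f = {p. d dvd p} \<and> lowest_coeff d = 1)"

definition k_kernel :: "nat \<Rightarrow> (nat \<Rightarrow> 'a) \<Rightarrow> (nat \<Rightarrow> 'a) set" where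
  "k_kernel k a = {(\<lambda>n. a (k ^ e * n + r)) | e r. r < k ^ e}"

definition seq_scale :: "'a::field \<Rightarrow> (nat \<Rightarrow> 'a) \<Rightarrow> nat \<Rightarrow> 'a" where
  "seq_scale c a = (\<lambda>n. c * a n)"

lemma vector_space_seq_scale: "vector_space (seq_scale :: 'a::field \<Rightarrow> _)"
  by standard (auto simp: seq_scale_def fun_eq_iff algebra_simps)

definition k_regular :: "nat \<Rightarrow> 'a::field fps \<Rightarrow> bool" where
  "k_regular k f \<longleftrightarrow>
     (\<exists>B. finite B \<and>
        module.span seq_scale B = module.span seq_scale (k_kernel k (fps_nth f)))"

definition is_root_of_unity :: "'a::field \<Rightarrow> bool" where
  "is_root_of_unity x \<longleftrightarrow> (\<exists>m::nat. m > 0 \<and> x ^ m = 1)"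

definition root_of_unity_order :: "'a::field \<Rightarrow> nat" where
  "root_of_unity_order x = (LEAST m. m > 0 \<and> x ^ m = 1)"


lemma lowest_coeff_smult:
  fixes p :: "'a::field poly"
  assumes "c \<noteq> 0"
  shows "lowest_coeff (smult c p) = c * lowest_coeff p"
  using assms by (simp add: lowest_coeff_def)

lemma lowest_coeff_nonzero:
  fixes p :: "'a::field poly"
  assumes "p \<noteq> 0"
  shows "lowest_coeff p \<noteq> 0"
proof -
  from assms have "\<exists>n. coeff p n \<noteq> 0" by (auto simp: poly_eq_iff)
  then show ?thesis unfolding lowest_coeff_def by (rule LeastI_ex)
qed

lemma mahler_ideal_diff:
  fixes f :: "'a::field fps"
  assumes "p \<in> mahler_ideal k f" "p' \<in> mahler_ideal k f"
  shows "p - p' \<in> mahler_ideal k f"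
proof -
  let ?g = "\<lambda>i. f oo fps_X ^ (k ^ i)"
  obtain n q where 1: "fps_of_poly p * f = (\<Sum>i=1..n. fps_of_poly (q i) * ?g i)"
    using assms(1) by (auto simp: mahler_ideal_def)
  obtain n' q' where 2: "fps_of_poly p' * f = (\<Sum>i=1..n'. fps_of_poly (q' i) * ?g i)"
    using assms(2) by (auto simp: mahler_ideal_def)
  define N where "N = max n n'"
  have ext: "(\<Sum>i=1..m. fps_of_poly (r i) * ?g i) =
             (\<Sum>i=1..N. fps_of_poly (if i \<le> m then r i else 0) * ?g i)" if "m \<le> N" for m r
    by (rule sum.mono_neutral_cong_left) (use that in auto)
  have "fps_of_poly (p - p') * f =
          (\<Sum>i=1..N. fps_of_poly (if i \<le> n then q i else 0) * ?g i) -
          (\<Sum>i=1..N. fps_of_poly (if i \<le> n' then q' i else 0) * ?g i)"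
    using 1 2 ext[of n q] ext[of n' q'] by (simp add: fps_of_poly_diff left_diff_distrib N_def)
  also have "\<dots> = (\<Sum>i=1..N. fps_of_poly ((if i \<le> n then q i else 0) -
                                 (if i \<le> n' then q' i else 0)) * ?g i)"
    unfolding sum_subtractf [symmetric] by (simp only: fps_of_poly_diff left_diff_distrib)
  finally show ?thesis unfolding mahler_ideal_def
    by (intro CollectI exI[of _ N]
          exI[of _ "\<lambda>i. (if i \<le> n then q i else 0) - (if i \<le> n' then q' i else 0)"])
qed

lemma mahler_ideal_mult:
  fixes f :: "'a::field fps"
  assumes "p \<in> mahler_ideal k f"
  shows "r * p \<in> mahler_ideal k f"
proof -
  let ?g = "\<lambda>i. f oo fps_X ^ (k ^ i)"
  obtain n q where 1: "fps_of_poly p * f = (\<Sum>i=1..n. fps_of_poly (q i) * ?g i)"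
    using assms by (auto simp: mahler_ideal_def)
  have "fps_of_poly (r * p) * f = fps_of_poly r * (fps_of_poly p * f)"
    by (simp add: fps_of_poly_mult mult.assoc)
  also have "\<dots> = (\<Sum>i=1..n. fps_of_poly (r * q i) * ?g i)"
    unfolding 1 sum_distrib_left by (simp only: fps_of_poly_mult mult.assoc)
  finally show ?thesis unfolding mahler_ideal_def
    by (intro CollectI exI[of _ n] exI[of _ "\<lambda>i. r * q i"])
qed

lemma mahler_ideal_nontrivial:
  fixes f :: "'a::field fps"
  assumes "is_mahler k f"
  shows "\<exists>p\<in>mahler_ideal k f. p \<noteq> 0"
proof -
  let ?g = "\<lambda>i. f oo fps_X ^ (k ^ i)"
  obtain d :: nat and p where p: "p 0 \<noteq> 0" "(\<Sum>i=0..d. fps_of_poly (p i) * ?g i) = 0"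
    using assms by (auto simp: is_mahler_def)
  have "(\<Sum>i=0..d. fps_of_poly (p i) * ?g i) =
          fps_of_poly (p 0) * f + (\<Sum>i=1..d. fps_of_poly (p i) * ?g i)"
    by (simp add: sum.atLeast_Suc_atMost)
  with p have "fps_of_poly (p 0) * f = - (\<Sum>i=1..d. fps_of_poly (p i) * ?g i)"
    by (simp add: eq_neg_iff_add_eq_0)
  also have "\<dots> = (\<Sum>i=1..d. fps_of_poly (- p i) * ?g i)"
    by (simp add: sum_negf fps_of_poly_uminus)
  finally have "p 0 \<in> mahler_ideal k f" unfolding mahler_ideal_def
    by (intro CollectI exI[of _ d] exI[of _ "\<lambda>i. - p i"])
  with p show ?thesis by blast
qed

lemma mahler_denominator_ex1:
  fixes f :: "'a::field fps"
  assumes "is_mahler k f"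
  shows "\<exists>!d. mahler_ideal k f = {p. d dvd p} \<and> lowest_coeff d = 1"
proof -
  let ?I = "mahler_ideal k f"
  define P where "P = (\<lambda>p. p \<in> ?I \<and> p \<noteq> 0)"
  have "\<exists>p. P p" using mahler_ideal_nontrivial[OF assms] by (auto simp: P_def)
  then obtain g where g: "P g" "\<And>p. P p \<Longrightarrow> degree g \<le> degree p"
    using exists_least_iff[of "\<lambda>n. \<exists>p. P p \<and> degree p = n"]
    by (metis linorder_not_less)
  have dvd: "g dvd p" if "p \<in> ?I" for p
  proof (rule ccontr)
    assume "\<not> g dvd p"
    then have nz: "p mod g \<noteq> 0" by (simp add: dvd_eq_mod_eq_0)
    have "p mod g = p - (p div g) * g" by (simp add: minus_div_mult_eq_mod)
    also have "\<dots> \<in> ?I"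
      using g(1) that by (intro mahler_ideal_diff mahler_ideal_mult) (auto simp: P_def)
    finally have "degree g \<le> degree (p mod g)" using nz g(2) by (auto simp: P_def)
    moreover have "degree (p mod g) < degree g"
      using g(1) nz degree_mod_less[of g p] by (auto simp: P_def)
    ultimately show False by simp
  qed
  have I: "?I = {p. g dvd p}"
    using dvd g(1) mahler_ideal_mult[of g k f] by (auto simp: P_def dvd_def mult.commute[of g])
  define c where "c = inverse (lowest_coeff g)"
  have c: "c \<noteq> 0" "c * lowest_coeff g = 1"
    using g(1) lowest_coeff_nonzero[of g] by (auto simp: c_def P_def)
  show ?thesis
  proof (rule ex1I[of _ "smult c g"])
    show "?I = {p. smult c g dvd p} \<and> lowest_coeff (smult c g) = 1"
      using c I by (simp add: lowest_coeff_smult smult_dvd_iff)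
  next
    fix d assume d: "?I = {p. d dvd p} \<and> lowest_coeff d = 1"
    have "d dvd g" "g dvd d" using d I by (metis (no_types) dvd_refl mem_Collect_eq)+
    then obtain r where r: "d = g * r" by (auto elim: dvdE)
    have "d \<noteq> 0" using \<open>d dvd g\<close> g(1) by (auto simp: P_def)
    have "degree d = degree g" using \<open>d dvd g\<close> \<open>g dvd d\<close> \<open>d \<noteq> 0\<close> g(1)
      by (intro antisym dvd_imp_degree_le) (auto simp: P_def)
    then have "degree r = 0" using r \<open>d \<noteq> 0\<close> by (auto simp: degree_mult_eq)
    then obtain b where "r = [:b:]" by (auto elim: degree_eq_zeroE)
    with r \<open>d \<noteq> 0\<close> have b: "d = smult b g" "b \<noteq> 0" by auto
    then have "b * lowest_coeff g = 1" using d by (simp add: lowest_coeff_smult)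
    then have "b = c" using c by (metis mult_right_cancel mult_zero_right zero_neq_one)
    with b show "d = smult c g" by simp
  qed
qed

lemma mahler_denominator_props:
  fixes f :: "'a::field fps"
  assumes "is_mahler k f"
  shows "mahler_ideal k f = {p. mahler_denominator k f dvd p}"
    and "lowest_coeff (mahler_denominator k f) = 1"
  using theI'[OF mahler_denominator_ex1[OF assms]] by (simp_all add: mahler_denominator_def)

end

theory Submission
  imports Defs
begin

text \<open>
  Write \<open>M\<^sub>j\<close> for the \<open>K[z]\<close>-module spanned by the \<open>f(z^(k^i))\<close> with \<open>i \<ge> j\<close>, and \<open>d\<close> for the Mahler
  denominator.

  If the non-zero roots of \<open>d\<close> are roots of unity of order not coprime to \<open>k\<close>, then \<open>d\<close> divides
  \<open>z^a Q^a\<close>, where \<open>Q = (1 - z^(n k^s)) / (1 - z^n)\<close>, and \<open>Q^a = h(z^k) / h(z)\<close> for the product \<open>h\<close> of the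
  \<open>(1 - z^(n k^j))^a\<close> with \<open>j < s\<close>. Hence \<open>g = f / h\<close> has a power of \<open>z\<close> as a denominator, and splitting
  off the first terms of \<open>g\<close> turns its equation into an inhomogeneous one with leading coefficient
  \<open>1\<close>, for which bounded degrees are preserved by the Cartier operators.

  Conversely, let \<open>f\<close> be regular. The kernel has a common denominator \<open>c\<close> relative to \<open>M\<^sub>0\<close>, and
  summing over residue classes gives \<open>c(z^(k^e)) f \<in> M\<^sub>e\<close> for all \<open>e\<close>; so \<open>d\<close> divides every \<open>c(z^(k^e))\<close>
  with \<open>e \<ge> 1\<close>, which makes its non-zero roots roots of unity. Suppose the order of a root \<open>x\<close> is coprime to
  \<open>k\<close>, and localize the \<open>M\<^sub>j\<close> at \<open>x\<close>. The order of vanishing of \<open>c(z^(k^e))\<close> at \<open>x\<close> is the same for all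
  \<open>e\<close> in an arithmetic progression, so one power of the minimal polynomial maps \<open>M\<^sub>0\<close> into every \<open>M\<^sub>j\<close>. As \<open>M\<^sub>0\<close> has
  finite rank, the chain of the localized \<open>M\<^sub>j\<close> is then eventually constant; but it drops whenever
  \<open>x^(k^j) = x\<close>, because \<open>d(z^(k^j))\<close> generates the annihilator of
  \<open>M\<^sub>j / M\<^sub>j\<^sub>+\<^sub>1\<close>.
\<close>

subsection \<open>The Mahler operator and the Cartier operators\<close>

definition dilate :: "nat \<Rightarrow> 'a::comm_ring_1 fps \<Rightarrow> 'a fps" where
  "dilate q x = x oo fps_X ^ q"

definition dilate_poly :: "nat \<Rightarrow> 'a::comm_ring_1 poly \<Rightarrow> 'a poly" where
  "dilate_poly q p = pcompose p (monom 1 q)"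

text \<open>With \<open>q = k ^ e\<close> and \<open>r < q\<close>, the values at \<open>f\<close>
  are the series of the \<open>k\<close>-kernel of \<open>f\<close>.\<close>

definition cartier :: "nat \<Rightarrow> nat \<Rightarrow> 'a fps \<Rightarrow> 'a fps" where
  "cartier q r x = Abs_fps (\<lambda>n. x $ (q * n + r))"

text \<open>The range \<open>n \<le> degree p\<close> suffices for \<open>q > 0\<close>, because
  then \<open>q * n + r\<close> exceeds \<open>degree p\<close> for all larger
  \<open>n\<close>.\<close>

definition cartier_poly :: "nat \<Rightarrow> nat \<Rightarrow> 'a::comm_ring_1 poly \<Rightarrow> 'a poly" where
  "cartier_poly q r p = (\<Sum>n\<le>degree p. monom (coeff p (q * n + r)) n)"

lemma dilate_nth:
  assumes "q > 0"
  shows "dilate q x $ n = (if q dvd n then x $ (n div q) else 0)"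
proof -
  have "dilate q x $ n = (\<Sum>i=0..n. x $ i * (if n = q * i then 1 else 0))"
    by (simp add: dilate_def fps_compose_nth flip: power_mult)
  also have "\<dots> = (\<Sum>i\<in>(if q dvd n then {n div q} else {}). x $ i)"
    by (rule sum.mono_neutral_cong_right) (use assms in \<open>auto split: if_splits\<close>)
  finally show ?thesis by simp
qed

lemma dilate_add: "dilate q (x + y) = dilate q x + dilate q y"
  by (simp add: dilate_def fps_compose_add_distrib)

lemma dilate_0 [simp]: "dilate q 0 = 0"
  by (simp add: dilate_def)

lemma dilate_sum: "dilate q (\<Sum>i\<in>A. x i) = (\<Sum>i\<in>A. dilate q (x i))"
  by (simp add: dilate_def fps_compose_sum_distrib)

lemma dilate_mult:
  fixes x :: "'a::idom fps"
  shows "q > 0 \<Longrightarrow> dilate q (x * y) = dilate q x * dilate q y"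
  by (simp add: dilate_def fps_compose_mult_distrib)

lemma dilate_1 [simp]: "dilate (Suc 0) x = x"
  by (simp add: dilate_def)

lemma dilate_dilate:
  assumes "q > 0" "r > 0"
  shows "dilate q (dilate r x) = dilate (q * r) x"
proof (rule fps_ext)
  fix n
  have "r * q dvd n \<longleftrightarrow> r dvd n div q" if "q dvd n"
    using that assms by (simp add: dvd_div_iff_mult mult.commute)
  moreover have "q dvd n" if "q * r dvd n"
    using that by (rule dvd_mult_left)
  ultimately show "dilate q (dilate r x) $ n = dilate (q * r) x $ n"
    using assms by (auto simp: dilate_nth div_mult2_eq mult.commute)
qed

lemma dilate_fps_X_power:
  fixes q :: nat
  assumes "q > 0"
  shows "dilate q (fps_X ^ n :: 'a::idom fps) = fps_X ^ (q * n)"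
  using assms by (simp add: dilate_def fps_X_power_compose power_mult)

lemma fps_of_poly_dilate_poly:
  fixes p :: "'a::idom poly"
  shows "q > 0 \<Longrightarrow> fps_of_poly (dilate_poly q p) = dilate q (fps_of_poly p)"
  by (simp add: dilate_poly_def dilate_def fps_of_poly_pcompose fps_of_poly_monom')

lemma dilate_poly_eq_0_iff [simp]:
  fixes p :: "'a::idom poly"
  shows "q > 0 \<Longrightarrow> dilate_poly q p = 0 \<longleftrightarrow> p = 0"
  by (simp add: dilate_poly_def pcompose_eq_0_iff degree_monom_eq)

lemma dilate_poly_mult: "dilate_poly q (p * r) = dilate_poly q p * dilate_poly q r"
  by (simp add: dilate_poly_def pcompose_mult)

lemma dilate_poly_power: "dilate_poly q (p ^ n) = dilate_poly q p ^ n"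
  by (induction n) (simp_all add: dilate_poly_mult, simp add: dilate_poly_def pcompose_1)

lemma dilate_poly_monom:
  fixes c :: "'a::idom"
  assumes "q > 0"
  shows "dilate_poly q (monom c n) = monom c (q * n)"
proof -
  have "dilate q (fps_const c * fps_X ^ n) = fps_const c * fps_X ^ (q * n)"
    using assms by (simp add: dilate_mult dilate_fps_X_power) (simp add: dilate_def)
  then show ?thesis
    using assms by (simp add: fps_of_poly_dilate_poly fps_of_poly_monom flip: fps_of_poly_eq_iff)
qed

lemma dilate_poly_sum: "dilate_poly q (\<Sum>i\<in>A. p i) = (\<Sum>i\<in>A. dilate_poly q (p i))"
  by (simp add: dilate_poly_def pcompose_sum)

lemma dilate_poly_dvd: "p dvd r \<Longrightarrow> dilate_poly q p dvd dilate_poly q r"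
  by (auto simp: dvd_def dilate_poly_mult)

lemma dilate_poly_dilate_poly:
  fixes p :: "'a::idom poly"
  assumes "q > 0" "r > 0"
  shows "dilate_poly q (dilate_poly r p) = dilate_poly (q * r) p"
  using assms dilate_dilate[of q r "fps_of_poly p"]
  by (simp add: fps_of_poly_dilate_poly flip: fps_of_poly_eq_iff)

section \<open>Cartier operators on power series\<close>

lemma cartier_nth [simp]: "cartier q r x $ n = x $ (q * n + r)"
  by (simp add: cartier_def)

lemma cartier_add: "cartier q r (x + y) = cartier q r x + cartier q r y"
  by (simp add: fps_eq_iff)

lemma cartier_0 [simp]: "cartier q r 0 = 0"
  by (simp add: fps_eq_iff)

lemma cartier_sum: "cartier q r (\<Sum>i\<in>A. x i) = (\<Sum>i\<in>A. cartier q r (x i))"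
  by (simp add: fps_eq_iff fps_sum_nth)

lemma cartier_cartier: "cartier q r (cartier q' r' x) = cartier (q' * q) (q' * r + r') x"
  by (simp add: fps_eq_iff algebra_simps)

text \<open>Each exponent lies in exactly one residue class modulo \<open>q\<close>, so only one
  summand contributes to its coefficient.\<close>

lemma fps_eq_sum_cartier:
  fixes x :: "'a::comm_ring_1 fps"
  assumes "q > 0"
  shows "x = (\<Sum>r<q. fps_X ^ r * dilate q (cartier q r x))"
proof (rule fps_ext)
  fix n
  have "(\<Sum>r<q. fps_X ^ r * dilate q (cartier q r x)) $ n =
        (\<Sum>r<q. if n < r then 0 else if q dvd n - r then x $ n else 0)"
    unfolding fps_sum_nth by (rule sum.cong) (use assms in \<open>auto simp: fps_X_power_mult_nth dilate_nth\<close>)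
  also have "\<dots> = (\<Sum>r\<in>{n mod q}. x $ n)"
  proof (rule sum.mono_neutral_cong_right, goal_cases)
    case 3
    have *: "r = n mod q" if "r < q" "r \<le> n" "q dvd n - r" for r
    proof -
      from that(3) obtain s where "n - r = q * s" ..
      then have "n = q * s + r" using that by simp
      then show ?thesis using that by simp
    qed
    show ?case using * by auto
  next
    case (4 r)
    then show ?case
      using leD[OF mod_less_eq_dividend[of n q]] by (simp add: minus_mod_eq_mult_div)
  qed (use assms in simp_all)
  finally show "x $ n = (\<Sum>r<q. fps_X ^ r * dilate q (cartier q r x)) $ n" by simp
qed

lemma cartier_fps_X_power_mult_dilate:
  fixes x :: "'a::comm_ring_1 fps"
  assumes "r < q" "s < q"
  shows "cartier q r (fps_X ^ s * dilate q x) = (if r = s then x else 0)"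
proof (rule fps_ext)
  fix n
  have "r = s" if "s \<le> q * n + r" "q dvd q * n + r - s"
  proof -
    from that(2) obtain t where "q * n + r - s = q * t" ..
    then have "q * n + r = q * t + s" using that by simp
    then have "(q * n + r) mod q = (q * t + s) mod q" by simp
    then show ?thesis using assms by simp
  qed
  then show "cartier q r (fps_X ^ s * dilate q x) $ n = (if r = s then x else 0) $ n"
    using assms by (auto simp: fps_X_power_mult_nth dilate_nth)
qed

text \<open>Multiplication by a series in \<open>z^q\<close> preserves the residue class of every
  exponent, so it respects the splitting of \<open>x\<close> into its classes.\<close>

lemma cartier_mult_dilate:
  fixes x :: "'a::idom fps"
  assumes "r < q"
  shows "cartier q r (x * dilate q y) = cartier q r x * y"
proof -
  have "x * dilate q y = (\<Sum>s<q. fps_X ^ s * dilate q (cartier q s x * y))"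
    using assms fps_eq_sum_cartier[of q x]
    by (metis (no_types, lifting) dilate_mult gr_zeroI mult.assoc not_less_zero sum.cong sum_distrib_right)
  then have "cartier q r (x * dilate q y) = (\<Sum>s<q. if r = s then cartier q s x * y else 0)"
    using assms by (simp add: cartier_sum cartier_fps_X_power_mult_dilate)
  then show ?thesis using assms by simp
qed

section \<open>Cartier operators on polynomials\<close>

lemma coeff_cartier_poly:
  assumes "q > 0"
  shows "coeff (cartier_poly q r p) n = coeff p (q * n + r)"
proof -
  have "coeff p (q * n + r) = 0" if "n > degree p"
  proof (rule coeff_eq_0)
    have "1 * n \<le> q * n" using assms by (intro mult_right_mono) auto
    with that show "degree p < q * n + r" by linarith
  qed
  then show ?thesis by (auto simp: cartier_poly_def coeff_sum)
qed

lemma fps_of_poly_cartier_poly: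
  assumes "q > 0"
  shows "fps_of_poly (cartier_poly q r p) = cartier q r (fps_of_poly p)"
  using assms by (simp add: fps_eq_iff coeff_cartier_poly)

lemma degree_cartier_poly:
  assumes "q > 0"
  shows "degree (cartier_poly q r p) \<le> degree p div q"
proof (rule degree_le, intro allI impI)
  fix n assume "degree p div q < n"
  then have "degree p < q * n + r"
    using assms by (simp add: div_less_iff_less_mult mult.commute trans_less_add1)
  then show "coeff (cartier_poly q r p) n = 0"
    using assms by (simp add: coeff_cartier_poly coeff_eq_0)
qed

lemma cartier_poly_mult_dilate:
  fixes p :: "'a::idom poly"
  assumes "r < q"
  shows "cartier q r (fps_of_poly p * dilate q y) = fps_of_poly (cartier_poly q r p) * y"
  using assms by (simp add: cartier_mult_dilate fps_of_poly_cartier_poly)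

text \<open>\<open>p\<close> is the sum of its dilated sections times powers of \<open>z\<close>,
  and dilation preserves divisibility.\<close>

lemma dvd_cartier_polys_imp_dilate_poly_dvd:
  fixes p :: "'a::idom poly"
  assumes "q > 0" and "\<And>r. r < q \<Longrightarrow> d dvd cartier_poly q r p"
  shows "dilate_poly q d dvd p"
proof -
  have "p = (\<Sum>r<q. monom 1 r * dilate_poly q (cartier_poly q r p))"
    using fps_eq_sum_cartier[OF assms(1), of "fps_of_poly p"] assms(1)
    by (simp add: fps_of_poly_dilate_poly fps_of_poly_cartier_poly fps_of_poly_sum
        fps_of_poly_mult fps_of_poly_monom' flip: fps_of_poly_eq_iff)
  also have "dilate_poly q d dvd \<dots>"
    using assms by (intro dvd_sum dvd_mult dilate_poly_dvd) auto
  finally show ?thesis .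
qed

subsection \<open>Linear systems and multiples in a power of the variable\<close>

text \<open>Fraction-free Gaussian elimination, so that the solution stays in the integral domain.
  It serves for scalars in \<open>K\<close> and for polynomials in \<open>K[z]\<close>.\<close>

lemma homogeneous_system_nontrivial_solution:
  fixes a :: "'b \<Rightarrow> nat \<Rightarrow> 'r::idom"
  assumes "finite A" "card A > n"
  shows "\<exists>p. (\<exists>l\<in>A. p l \<noteq> 0) \<and> (\<forall>i<n. (\<Sum>l\<in>A. p l * a l i) = 0)"
  using assms
proof (induction n arbitrary: A a)
  case 0
  then obtain l where "l \<in> A" by fastforce
  then show ?case by (intro exI[of _ "\<lambda>_. 1"]) auto
next
  case (Suc n)
  show ?case
  proof (cases "\<forall>l\<in>A. a l n = 0")
    case True
    obtain p where "\<exists>l\<in>A. p l \<noteq> 0" "\<forall>i<n. (\<Sum>l\<in>A. p l * a l i) = 0"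
      using Suc.IH[of A a] Suc.prems by auto
    with True show ?thesis by (intro exI[of _ p]) (auto simp: less_Suc_eq)
  next
    case False
    then obtain t where t: "t \<in> A" "a t n \<noteq> 0" by auto
    \<comment> \<open>Equation \<open>n\<close> is solved for the unknown at \<open>t\<close>;
      substituting and clearing the pivot \<open>a t n\<close> gives the system \<open>b\<close> in
      the other unknowns.\<close>
    define b where "b = (\<lambda>l i. a t n * a l i - a l n * a t i)"
    have "card (A - {t}) > n" using Suc.prems t by simp
    then obtain p where p: "\<exists>l\<in>A-{t}. p l \<noteq> 0" "\<forall>i<n. (\<Sum>l\<in>A-{t}. p l * b l i) = 0"
      using Suc.IH[of "A - {t}" b] Suc.prems by auto
    \<comment> \<open>Scaling the other unknowns by the pivot makes the value at \<open>t\<close>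
      computable without division.\<close>
    define p' where "p' = (\<lambda>l. if l = t then - (\<Sum>l\<in>A-{t}. p l * a l n) else p l * a t n)"
    have *: "(\<Sum>l\<in>A. p' l * a l i) = (\<Sum>l\<in>A-{t}. p l * b l i)" for i
    proof -
      have "(\<Sum>l\<in>A. p' l * a l i) = p' t * a t i + (\<Sum>l\<in>A-{t}. p' l * a l i)"
        using Suc.prems t by (simp add: sum.remove)
      also have "p' t * a t i = (\<Sum>l\<in>A-{t}. - p l * a l n * a t i)"
        by (simp add: p'_def sum_distrib_right sum_negf)
      also have "(\<Sum>l\<in>A-{t}. p' l * a l i) = (\<Sum>l\<in>A-{t}. p l * a t n * a l i)"
        by (rule sum.cong) (auto simp: p'_def)
      finally show ?thesis
        by (simp add: sum.distrib[symmetric] b_def algebra_simps)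
    qed
    have "(\<Sum>l\<in>A. p' l * a l i) = 0" if "i < Suc n" for i
      using that p(2) unfolding * by (cases "i = n") (auto simp: b_def mult.commute)
    moreover have "\<exists>l\<in>A. p' l \<noteq> 0"
      using p(1) t by (auto simp: p'_def)
    ultimately show ?thesis by blast
  qed
qed

lemma mod_poly_sum:
  fixes s :: "'a::field poly"
  shows "(\<Sum>i\<in>A. p i) mod s = (\<Sum>i\<in>A. p i mod s)"
  by (induction A rule: infinite_finite_induct) (simp_all add: poly_mod_add_left)

text \<open>The \<open>degree s + 1\<close> remainders of \<open>z^(q l)\<close> modulo
  \<open>s\<close> with \<open>l \<le> degree s\<close> lie in a space of dimension
  \<open>degree s\<close>, so they satisfy a linear relation; its coefficients form
  \<open>t\<close>.\<close>

lemma exists_dilate_poly_multiple: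
  fixes s :: "'a::field poly"
  assumes "s \<noteq> 0" "q > 0"
  obtains t where "t \<noteq> 0" "s dvd dilate_poly q t"
proof -
  define m where "m = degree s"
  obtain c where c: "\<exists>l\<le>m. c l \<noteq> 0"
    "\<forall>i<m. (\<Sum>l\<le>m. c l * coeff (monom 1 (q * l) mod s) i) = 0"
    using homogeneous_system_nontrivial_solution[of "{..m}" m "\<lambda>l. coeff (monom 1 (q * l) mod s)"] by auto
  define t where "t = (\<Sum>l\<le>m. monom (c l) l)"
  have "coeff t l = (if l \<le> m then c l else 0)" for l
    by (auto simp: t_def coeff_sum)
  then have "t \<noteq> 0" using c(1) by (auto simp: poly_eq_iff)
  have "dilate_poly q t = (\<Sum>l\<le>m. smult (c l) (monom 1 (q * l)))"
    using assms by (simp add: t_def dilate_poly_sum dilate_poly_monom smult_monom)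
  then have "dilate_poly q t mod s = (\<Sum>l\<le>m. smult (c l) (monom 1 (q * l) mod s))" (is "_ = ?R")
    by (simp add: mod_poly_sum mod_smult_left)
  also have "?R = 0"
  proof (rule poly_eqI)
    fix i
    show "coeff ?R i = coeff 0 i"
    proof (cases "i < m")
      case True
      then show ?thesis using c(2) by (simp add: coeff_sum)
    next
      case False
      have "coeff (r mod s) i = 0" for r
      \<comment> \<open>A constant \<open>s\<close> is a unit, so every remainder is 0; the degree
        bound for remainders says nothing here.\<close>
      proof (cases "m = 0")
        case True
        then obtain a where "s = [:a:]" "a \<noteq> 0" using assms by (auto simp: m_def elim: degree_eq_zeroE)
        then have "s dvd r" by (simp add: const_poly_dvd_iff dvd_field_iff)
        then show ?thesis by simp
      next
        case f: False
        then show ?thesis using False degree_mod_less'[of s r] assms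
          by (metis coeff_0 coeff_eq_0 linorder_not_less m_def order.strict_trans1 degree_mod_less)
      qed
      then show ?thesis by (simp add: coeff_sum)
    qed
  qed
  finally show ?thesis using \<open>t \<noteq> 0\<close> that by (simp add: dvd_eq_mod_eq_0)
qed

subsection \<open>The modules generated by the dilates of a power series\<close>

text \<open>The module \<open>M_j\<close>, built one term at a time, so that closure properties
  follow by induction without aligning the lengths of sums.\<close>

inductive_set mahler_module :: "nat \<Rightarrow> 'a::field fps \<Rightarrow> nat \<Rightarrow> 'a fps set"
  for k f j where
  zero: "0 \<in> mahler_module k f j"
| step: "j \<le> i \<Longrightarrow> x \<in> mahler_module k f j \<Longrightarrow>
    fps_of_poly p * dilate (k ^ i) f + x \<in> mahler_module k f j"

lemma mahler_module_add:
  "x \<in> mahler_module k f j \<Longrightarrow> y \<in> mahler_module k f j \<Longrightarrow> x + y \<in> mahler_module k f j"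
  by (induction rule: mahler_module.induct) (auto simp: add.assoc intro: mahler_module.intros)

lemma mahler_module_mult:
  "x \<in> mahler_module k f j \<Longrightarrow> fps_of_poly r * x \<in> mahler_module k f j"
proof (induction rule: mahler_module.induct)
  case (step i x p)
  then have "fps_of_poly (r * p) * dilate (k ^ i) f + fps_of_poly r * x \<in> mahler_module k f j"
    by (intro mahler_module.step)
  then show ?case by (simp add: fps_of_poly_mult algebra_simps)
qed (simp add: mahler_module.zero)

lemma mahler_module_sum:
  "(\<And>i. i \<in> A \<Longrightarrow> x i \<in> mahler_module k f j) \<Longrightarrow> (\<Sum>i\<in>A. x i) \<in> mahler_module k f j"
  by (induction A rule: infinite_finite_induct) (auto intro: mahler_module.zero mahler_module_add)

lemma dilate_in_mahler_module:
  assumes "j \<le> i" shows "dilate (k ^ i) f \<in> mahler_module k f j"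
  using mahler_module.step[OF assms mahler_module.zero, of 1] by simp

lemma mahler_module_antimono:
  assumes "i \<le> j" shows "mahler_module k f j \<subseteq> mahler_module k f i"
proof
  fix x assume "x \<in> mahler_module k f j"
  then show "x \<in> mahler_module k f i"
    using assms by induction (auto intro: mahler_module.intros)
qed

lemma dilate_mahler_module:
  assumes "k > 0" "x \<in> mahler_module k f j"
  shows "dilate (k ^ e) x \<in> mahler_module k f (j + e)"
  using assms(2)
proof induction
  case (step i x p)
  then have "fps_of_poly (dilate_poly (k ^ e) p) * dilate (k ^ (i + e)) f + dilate (k ^ e) x
      \<in> mahler_module k f (j + e)"
    by (intro mahler_module.step) auto
  then show ?case
    using assms(1)
    by (simp add: dilate_add dilate_mult dilate_dilate fps_of_poly_dilate_poly power_add mult.commute)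
qed (simp add: mahler_module.zero)

text \<open>For \<open>i \<ge> j + e\<close> the series \<open>f(z^(k^i))\<close> is the
  \<open>k^e\<close>-dilate of \<open>f(z^(k^(i - e)))\<close>, so the operator acts on the
  coefficient alone and lowers the index by \<open>e\<close>.\<close>

lemma cartier_mahler_module:
  assumes "k > 0" "x \<in> mahler_module k f (j + e)" "r < k ^ e"
  shows "cartier (k ^ e) r x \<in> mahler_module k f j"
  using assms(2)
proof induction
  case (step i x p)
  have "dilate (k ^ i) f = dilate (k ^ e) (dilate (k ^ (i - e)) f)"
    using assms(1) step.hyps(1) by (simp add: dilate_dilate flip: power_add)
  then have "cartier (k ^ e) r (fps_of_poly p * dilate (k ^ i) f)
      = fps_of_poly (cartier_poly (k ^ e) r p) * dilate (k ^ (i - e)) f"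
    using assms(3) by (simp add: cartier_poly_mult_dilate)
  moreover have "j \<le> i - e" using step.hyps(1) by simp
  ultimately show ?case
    using step.IH by (auto simp: cartier_add intro: mahler_module.step)
qed (simp add: mahler_module.zero)

lemma mahler_module_Suc_0_repr:
  assumes "x \<in> mahler_module k f (Suc 0)"
  shows "\<exists>n q. x = (\<Sum>i=1..n. fps_of_poly (q i) * dilate (k ^ i) f)"
  using assms
proof induction
  case zero
  show ?case by (intro exI[of _ 0]) simp
next
  case (step i x p)
  then obtain n q where q: "x = (\<Sum>i=1..n. fps_of_poly (q i) * dilate (k ^ i) f)" by auto
  \<comment> \<open>The index \<open>i\<close> may already occur among \<open>1..n\<close>, so the
    new coefficient is added to the old one.\<close>
  define q' where "q' = (\<lambda>l. (if l = i then p else 0) + (if l \<le> n then q l else 0))"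
  have "(\<Sum>l=1..max n i. fps_of_poly (q' l) * dilate (k ^ l) f) =
    (\<Sum>l=1..max n i. if l = i then fps_of_poly p * dilate (k ^ i) f else 0) +
    (\<Sum>l=1..max n i. if l \<le> n then fps_of_poly (q l) * dilate (k ^ l) f else 0)"
    unfolding sum.distrib[symmetric]
    by (rule sum.cong) (auto simp: q'_def fps_of_poly_add algebra_simps)
  also have "(\<Sum>l=1..max n i. if l \<le> n then fps_of_poly (q l) * dilate (k ^ l) f else 0) = x"
    unfolding q by (rule sum.mono_neutral_cong_right) auto
  finally show ?case using step by (intro exI[of _ "max n i"] exI[of _ q']) auto
qed

section \<open>Denominators and annihilators of the module quotients\<close>

lemma mahler_ideal_iff:
  "p \<in> mahler_ideal k f \<longleftrightarrow> fps_of_poly p * f \<in> mahler_module k f (Suc 0)"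
proof
  assume "p \<in> mahler_ideal k f"
  then show "fps_of_poly p * f \<in> mahler_module k f (Suc 0)"
    unfolding mahler_ideal_def dilate_def[symmetric]
    by (auto intro!: mahler_module_sum mahler_module_mult[OF dilate_in_mahler_module])
next
  assume "fps_of_poly p * f \<in> mahler_module k f (Suc 0)"
  from mahler_module_Suc_0_repr[OF this] show "p \<in> mahler_ideal k f"
    unfolding mahler_ideal_def by (simp add: dilate_def)
qed

lemma mahler_denominator_dvd_iff:
  assumes "is_mahler k f"
  shows "mahler_denominator k f dvd p \<longleftrightarrow> fps_of_poly p * f \<in> mahler_module k f (Suc 0)"
  using mahler_denominator_props(1)[OF assms] by (auto simp flip: mahler_ideal_iff)

lemma mahler_denominator_nonzero:
  assumes "is_mahler k f"
  shows "mahler_denominator k f \<noteq> 0"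
  using mahler_ideal_nontrivial[OF assms] mahler_denominator_props(1)[OF assms] by auto

text \<open>Half of the claim that the dilated denominator generates the annihilator of
  \<open>M_j / M_(j+1)\<close>. Every Cartier operator of level \<open>j\<close> turns the
  membership into one in \<open>M_1\<close>, which makes the denominator divide that section of
  \<open>u\<close>.\<close>

lemma dilate_mahler_denominator_dvd:
  assumes "is_mahler k f" "k > 0" "fps_of_poly u * dilate (k ^ j) f \<in> mahler_module k f (Suc j)"
  shows "dilate_poly (k ^ j) (mahler_denominator k f) dvd u"
proof (rule dvd_cartier_polys_imp_dilate_poly_dvd)
  fix r assume "r < k ^ j"
  then have "cartier (k ^ j) r (fps_of_poly u * dilate (k ^ j) f) \<in> mahler_module k f (Suc 0)"
    using assms by (intro cartier_mahler_module) auto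
  then show "mahler_denominator k f dvd cartier_poly (k ^ j) r u"
    using assms(1) \<open>r < k ^ j\<close> by (simp add: mahler_denominator_dvd_iff cartier_poly_mult_dilate)
qed (use assms in simp)

text \<open>Multiplication by \<open>d(z^(k^e))\<close> maps \<open>M_e\<close> into
  \<open>M_(e+1)\<close>, since it disposes of the single generator of index \<open>e\<close>; a
  product of such factors reaches every level.\<close>

lemma mahler_module_tail_multiple:
  assumes "is_mahler k f" "k > 0"
  shows "\<exists>c. c \<noteq> 0 \<and> fps_of_poly c * f \<in> mahler_module k f e"
proof (induction e)
  case 0
  show ?case using dilate_in_mahler_module[of 0 0 k f] by (intro exI[of _ 1]) simp
next
  case (Suc e)
  then obtain c where c: "c \<noteq> 0" "fps_of_poly c * f \<in> mahler_module k f e" by auto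
  define d where "d = mahler_denominator k f"
  define D where "D = dilate_poly (k ^ e) d"
  have "d \<noteq> 0" using mahler_denominator_nonzero[OF assms(1)] by (simp add: d_def)
  then have D0: "D \<noteq> 0" using assms by (simp add: D_def)
  have "fps_of_poly d * f \<in> mahler_module k f (Suc 0)"
    using mahler_denominator_dvd_iff[OF assms(1), of d] by (simp add: d_def)
  from dilate_mahler_module[OF assms(2) this, of e]
  have D: "fps_of_poly D * dilate (k ^ e) f \<in> mahler_module k f (Suc e)"
    using assms(2) by (simp add: D_def dilate_mult fps_of_poly_dilate_poly)
  have "fps_of_poly D * x \<in> mahler_module k f (Suc e)" if "x \<in> mahler_module k f e" for x
    using that
  proof induction
    case (step i x p)
    have "fps_of_poly D * (fps_of_poly p * dilate (k ^ i) f) \<in> mahler_module k f (Suc e)"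
    proof (cases "i = e")
      case True
      then show ?thesis using mahler_module_mult[OF D, of p] by (simp add: mult_ac)
    next
      case False
      with step show ?thesis by (intro mahler_module_mult dilate_in_mahler_module) auto
    qed
    with step show ?case by (auto simp: distrib_left intro: mahler_module_add)
  qed (simp add: mahler_module.zero)
  from this[OF c(2)] have "fps_of_poly (D * c) * f \<in> mahler_module k f (Suc e)"
    by (simp add: fps_of_poly_mult mult.assoc)
  with c(1) D0 show ?case by (intro exI[of _ "D * c"]) auto
qed

text \<open>A dilated polynomial can be pulled out of the Cartier operator; therefore the multiplier
  \<open>s\<close> of \<open>f\<close> is first enlarged to one of the form
  \<open>t(z^(k^e))\<close>.\<close>

lemma cartier_multiple_in_mahler_module:
  assumes "is_mahler k f" "k > 0" "r < k ^ e"
  shows "\<exists>c. c \<noteq> 0 \<and> fps_of_poly c * cartier (k ^ e) r f \<in> mahler_module k f 0"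
proof -
  obtain s where s: "s \<noteq> 0" "fps_of_poly s * f \<in> mahler_module k f e"
    using mahler_module_tail_multiple[OF assms(1,2)] by blast
  obtain t where t: "t \<noteq> 0" "s dvd dilate_poly (k ^ e) t"
    using exists_dilate_poly_multiple[of s "k ^ e"] s(1) assms(2) by auto
  then obtain w where w: "dilate_poly (k ^ e) t = w * s" by (auto simp: dvd_def mult.commute)
  have "f * dilate (k ^ e) (fps_of_poly t) = fps_of_poly w * (fps_of_poly s * f)"
    using assms(2) by (simp add: w fps_of_poly_mult mult_ac flip: fps_of_poly_dilate_poly)
  also have "\<dots> \<in> mahler_module k f (0 + e)"
    using s(2) by (simp add: mahler_module_mult)
  finally have "cartier (k ^ e) r (f * dilate (k ^ e) (fps_of_poly t)) \<in> mahler_module k f 0"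
    using assms(2,3) by (intro cartier_mahler_module)
  with t(1) assms(3) show ?thesis by (auto simp: cartier_mult_dilate mult.commute)
qed

text \<open>The dilated sections of \<open>f\<close> reassemble to \<open>f\<close>, and dilating
  \<open>c\<close> times a section moves it from \<open>M_0\<close> into \<open>M_e\<close>.\<close>

lemma dilate_poly_mult_in_mahler_module:
  assumes "k > 0"
    and "\<And>r. r < k ^ e \<Longrightarrow> fps_of_poly c * cartier (k ^ e) r f \<in> mahler_module k f 0"
  shows "fps_of_poly (dilate_poly (k ^ e) c) * f \<in> mahler_module k f e"
proof -
  let ?q = "k ^ e"
  have "fps_of_poly (dilate_poly ?q c) * f =
    (\<Sum>r<?q. fps_of_poly (monom 1 r) * dilate ?q (fps_of_poly c * cartier ?q r f))"
    using assms(1) arg_cong[OF fps_eq_sum_cartier[of ?q f], of "\<lambda>x. dilate ?q (fps_of_poly c) * x"]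
    by (simp add: sum_distrib_left dilate_mult fps_of_poly_dilate_poly fps_of_poly_monom' mult_ac)
  also have "\<dots> \<in> mahler_module k f (0 + e)"
    by (intro mahler_module_sum mahler_module_mult[OF dilate_mahler_module[OF assms(1) assms(2)]]) simp
  finally show ?thesis by simp
qed

subsection \<open>Regularity\<close>

interpretation seq: vector_space "seq_scale :: 'a::field \<Rightarrow> (nat \<Rightarrow> 'a) \<Rightarrow> nat \<Rightarrow> 'a"
  by (rule vector_space_seq_scale)

lemma k_kernel_eq: "k_kernel k (fps_nth f) = {fps_nth (cartier (k ^ e) r f) | e r. r < k ^ e}"
proof -
  have "fps_nth (cartier q r f) = (\<lambda>n. f $ (q * n + r))" for q r
    by (simp add: fun_eq_iff)
  then show ?thesis by (simp add: k_kernel_def)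
qed

text \<open>A denominator valid on a finite spanning set is valid on its span, and the product of
  the individual denominators is valid on the set.\<close>

lemma k_regular_common_multiple:
  assumes "is_mahler k f" "k > 0" "k_regular k f"
  obtains c where "c \<noteq> 0"
    and "\<And>e r. r < k ^ e \<Longrightarrow> fps_of_poly c * cartier (k ^ e) r f \<in> mahler_module k f 0"
proof -
  define E where "E = (\<lambda>c. {a. fps_of_poly c * Abs_fps a \<in> mahler_module k f 0})"
  have subspace: "seq.subspace (E c)" for c
  proof (rule seq.subspaceI)
    show "0 \<in> E c" by (simp add: E_def zero_fun_def flip: fps_zero_def) (rule mahler_module.zero)
  next
    fix x y assume "x \<in> E c" "y \<in> E c"
    moreover have "Abs_fps (x + y) = Abs_fps x + Abs_fps y" by (simp add: fps_eq_iff)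
    ultimately show "x + y \<in> E c" by (simp add: E_def distrib_left mahler_module_add)
  next
    fix a x assume "x \<in> E c"
    then have "fps_of_poly [:a:] * (fps_of_poly c * Abs_fps x) \<in> mahler_module k f 0"
      unfolding E_def by (intro mahler_module_mult[of "fps_of_poly c * _"]) auto
    moreover have "Abs_fps (seq_scale a x) = fps_of_poly [:a:] * Abs_fps x"
      by (simp add: fps_eq_iff seq_scale_def fps_of_poly_const)
    ultimately show "seq_scale a x \<in> E c" by (simp add: E_def mult.left_commute)
  qed
  have E_mult: "E c \<subseteq> E (c' * c)" for c c'
    by (auto simp: E_def fps_of_poly_mult mult.assoc intro: mahler_module_mult)
  \<comment> \<open>The spanning set need not consist of kernel sequences; its members have
    denominators because the sequences with some denominator form a subspace.\<close>
  have "seq.subspace {a. \<exists>c. c \<noteq> 0 \<and> a \<in> E c}"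
  proof (rule seq.subspaceI)
    show "0 \<in> {a. \<exists>c. c \<noteq> 0 \<and> a \<in> E c}"
      using seq.subspace_0[OF subspace[of 1]] by (auto intro: exI[of _ 1])
  next
    fix x y assume "x \<in> {a. \<exists>c. c \<noteq> 0 \<and> a \<in> E c}" "y \<in> {a. \<exists>c. c \<noteq> 0 \<and> a \<in> E c}"
    then obtain c c' where "c \<noteq> 0" "c' \<noteq> 0" "x \<in> E c" "y \<in> E c'" by auto
    then have "c' * c \<noteq> 0" "x \<in> E (c' * c)" "y \<in> E (c' * c)"
      using E_mult[of c c'] E_mult[of c' c] by (auto simp: mult.commute)
    then show "x + y \<in> {a. \<exists>c. c \<noteq> 0 \<and> a \<in> E c}"
      using seq.subspace_add[OF subspace] by blast
  qed (use seq.subspace_scale[OF subspace] in blast)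
  moreover have "k_kernel k (fps_nth f) \<subseteq> {a. \<exists>c. c \<noteq> 0 \<and> a \<in> E c}"
    using cartier_multiple_in_mahler_module[OF assms(1,2)]
    by (auto simp: k_kernel_eq E_def fps_nth_inverse)
  ultimately have span: "seq.span (k_kernel k (fps_nth f)) \<subseteq> {a. \<exists>c. c \<noteq> 0 \<and> a \<in> E c}"
    by (intro seq.span_minimal)
  obtain B where B: "finite B" "seq.span B = seq.span (k_kernel k (fps_nth f))"
    using assms(3) by (auto simp: k_regular_def)
  have "\<forall>b\<in>B. \<exists>c. c \<noteq> 0 \<and> b \<in> E c"
    using span seq.span_superset[of B] unfolding B(2) by blast
  then obtain c where c: "\<And>b. b \<in> B \<Longrightarrow> c b \<noteq> 0 \<and> b \<in> E (c b)" by metis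
  define C where "C = (\<Prod>b\<in>B. c b)"
  have "b \<in> E C" if "b \<in> B" for b
    using E_mult[of "c b" "\<Prod>b\<in>B-{b}. c b"] c[OF that] B(1) that
    by (auto simp: C_def prod.remove mult.commute)
  then have "seq.span B \<subseteq> E C" by (intro seq.span_minimal subspace) auto
  then have "k_kernel k (fps_nth f) \<subseteq> E C"
    using seq.span_superset unfolding B(2) by blast
  then have "fps_of_poly C * cartier (k ^ e) r f \<in> mahler_module k f 0" if "r < k ^ e" for e r
  proof -
    have "fps_nth (cartier (k ^ e) r f) \<in> k_kernel k (fps_nth f)"
      using that unfolding k_kernel_eq by blast
    with \<open>k_kernel k (fps_nth f) \<subseteq> E C\<close> have "fps_nth (cartier (k ^ e) r f) \<in> E C" by blast
    then show ?thesis by (simp add: E_def fps_nth_inverse del: cartier_nth)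
  qed
  moreover have "C \<noteq> 0" using c B(1) by (auto simp: C_def)
  ultimately show ?thesis using that by blast
qed

text \<open>Reading \<open>r\<close> digit by digit in base \<open>k\<close> composes the operators
  \<open>cartier k r\<close>, so a stable space containing \<open>f\<close> contains the
  kernel.\<close>

lemma k_regularI:
  assumes "finite S" "fps_nth f \<in> seq.span S"
    and closed: "\<And>x r. fps_nth x \<in> seq.span S \<Longrightarrow> r < k \<Longrightarrow> fps_nth (cartier k r x) \<in> seq.span S"
  shows "k_regular k f"
proof -
  have ker: "fps_nth (cartier (k ^ e) r f) \<in> seq.span S" if "r < k ^ e" for e r
    using that
  proof (induction e arbitrary: r)
    case 0
    moreover have "cartier (Suc 0) 0 f = f" by (simp add: fps_eq_iff)
    ultimately show ?case using assms(2) by simp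
  next
    case (Suc e)
    have "k ^ e > 0" using Suc.prems by (cases "k ^ e") auto
    \<comment> \<open>The last \<open>e\<close> digits of \<open>r\<close> are handled by induction,
      the leading digit by \<open>closed\<close>.\<close>
    then have "r mod k ^ e < k ^ e" "r div k ^ e < k"
      using Suc.prems by (auto simp: div_less_iff_less_mult mult.commute)
    then have "fps_nth (cartier k (r div k ^ e) (cartier (k ^ e) (r mod k ^ e) f)) \<in> seq.span S"
      by (intro closed Suc.IH)
    moreover have "cartier k (r div k ^ e) (cartier (k ^ e) (r mod k ^ e) f) = cartier (k ^ Suc e) r f"
      unfolding cartier_cartier by (simp add: mult.commute[of k])
    ultimately show ?case by (simp del: cartier_nth)
  qed
  \<comment> \<open>The finite set must span exactly the span of the kernel, which may be smaller
    than that of \<open>S\<close>. A basis of the former is finite by comparison with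
    \<open>S\<close>.\<close>
  obtain B where B: "B \<subseteq> seq.span (k_kernel k (fps_nth f))" "seq.independent B"
    "seq.span (k_kernel k (fps_nth f)) \<subseteq> seq.span B"
    using seq.maximal_independent_subset by blast
  have "seq.span (k_kernel k (fps_nth f)) \<subseteq> seq.span S"
    using ker by (intro seq.span_minimal seq.subspace_span) (auto simp: k_kernel_eq)
  then have "finite B" using B seq.independent_span_bound[OF assms(1) B(2)] by blast
  moreover have "seq.span B = seq.span (k_kernel k (fps_nth f))"
    using B seq.span_minimal[OF B(1) seq.subspace_span] by blast
  ultimately show ?thesis unfolding k_regular_def by blast
qed

subsection \<open>Evaluation in the algebraic closure\<close>

definition ac_eval :: "'a::field alg_closure \<Rightarrow> 'a poly \<Rightarrow> 'a alg_closure" where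
  "ac_eval x p = poly (map_poly to_ac p) x"

lemma ac_eval_0 [simp]: "ac_eval x 0 = 0"
  by (simp add: ac_eval_def)

lemma ac_eval_pCons [simp]: "ac_eval x (pCons a p) = to_ac a + x * ac_eval x p"
  by (simp add: ac_eval_def map_poly_pCons)

lemma ac_eval_1 [simp]: "ac_eval x 1 = 1"
  by (simp add: one_pCons)

lemma ac_eval_add [simp]: "ac_eval x (p + q) = ac_eval x p + ac_eval x q"
  by (induction p q rule: poly_induct2) (simp_all add: algebra_simps)

lemma ac_eval_smult [simp]: "ac_eval x (smult c p) = to_ac c * ac_eval x p"
  by (induction p) (simp_all add: algebra_simps)

lemma ac_eval_mult [simp]: "ac_eval x (p * q) = ac_eval x p * ac_eval x q"
  by (induction p) (simp_all add: algebra_simps)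

lemma ac_eval_uminus [simp]: "ac_eval x (- p) = - ac_eval x p"
  by (induction p) (simp_all add: algebra_simps)

lemma ac_eval_diff [simp]: "ac_eval x (p - q) = ac_eval x p - ac_eval x q"
  using ac_eval_add[of x p "- q"] by simp

lemma ac_eval_power [simp]: "ac_eval x (p ^ n) = ac_eval x p ^ n"
  by (induction n) simp_all

lemma ac_eval_monom_1 [simp]: "ac_eval x (monom 1 n) = x ^ n"
  by (simp add: ac_eval_def map_poly_monom poly_monom)

lemma ac_eval_dilate_poly [simp]: "ac_eval x (dilate_poly q p) = ac_eval (x ^ q) p"
  unfolding dilate_poly_def by (induction p) (simp_all add: pcompose_pCons)

lemma finite_ac_roots:
  assumes "p \<noteq> 0"
  shows "finite {x. ac_eval x p = 0}"
proof -
  have "map_poly to_ac p \<noteq> 0" using assms by (simp add: map_poly_eq_0_iff)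
  then show ?thesis unfolding ac_eval_def by (rule poly_roots_finite)
qed

lemma ac_root_exists:
  assumes "degree p > 0"
  shows "\<exists>x. ac_eval x p = 0"
proof -
  have "degree (map_poly to_ac p) = degree p" by (rule degree_map_poly) auto
  then show ?thesis
    unfolding ac_eval_def using assms alg_closed_imp_poly_has_root[of "map_poly to_ac p"] by simp
qed

text \<open>An element of least degree in the kernel of evaluation at \<open>x\<close>; division
  with remainder gives the criterion.\<close>

lemma minimal_polynomial_exists:
  fixes p :: "'a::field poly"
  assumes "p \<noteq> 0" "ac_eval x p = 0"
  obtains m where "m \<noteq> 0" "\<And>q. m dvd q \<longleftrightarrow> ac_eval x q = 0"
proof -
  have "\<exists>m. (m \<noteq> 0 \<and> ac_eval x m = 0) \<and> (\<forall>q. q \<noteq> 0 \<and> ac_eval x q = 0 \<longrightarrow> degree m \<le> degree q)"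
    using assms ex_has_least_nat[of "\<lambda>m. m \<noteq> 0 \<and> ac_eval x m = 0" p degree] by blast
  then obtain m where m: "m \<noteq> 0" "ac_eval x m = 0"
    "\<And>q. q \<noteq> 0 \<Longrightarrow> ac_eval x q = 0 \<Longrightarrow> degree m \<le> degree q" by blast
  have "m dvd q" if "ac_eval x q = 0" for q
  proof (rule ccontr)
    assume "\<not> m dvd q"
    then have nz: "q mod m \<noteq> 0" by (simp add: dvd_eq_mod_eq_0)
    have "ac_eval x (q mod m) = 0"
      using that m(2) by (simp add: minus_mult_div_eq_mod[symmetric])
    with m(3) nz have "degree m \<le> degree (q mod m)" by blast
    with degree_mod_less[OF m(1), of q] nz show False by simp
  qed
  moreover have "ac_eval x q = 0" if "m dvd q" for q
    using that m(2) by (auto simp: dvd_def)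
  ultimately have "m dvd q \<longleftrightarrow> ac_eval x q = 0" for q by (rule iffI[rotated])
  then show ?thesis using that[OF m(1)] by simp
qed

lemma minimal_polynomial_degree_pos:
  assumes "m \<noteq> 0" "\<And>q. m dvd q \<longleftrightarrow> ac_eval x q = 0"
  shows "degree m > 0"
proof (rule ccontr)
  assume "\<not> degree m > 0"
  then have "is_unit m"
    using assms(1) by (auto elim!: degree_eq_zeroE simp: is_unit_const_poly_iff dvd_field_iff)
  then show False using assms(2)[of 1] by simp
qed

text \<open>The minimal polynomials of the roots are split off \<open>d\<close> one at a time. Each
  divides \<open>a\<close> and has positive degree, so \<open>degree d\<close> factors
  \<open>a\<close> suffice.\<close>

lemma dvd_power_degree_if_roots:
  fixes d a :: "'a::field poly"
  assumes "d \<noteq> 0" "\<And>x. ac_eval x d = 0 \<Longrightarrow> ac_eval x a = 0"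
  shows "d dvd a ^ degree d"
  using assms
proof (induction "degree d" arbitrary: d rule: less_induct)
  case less
  show ?case
  proof (cases "degree d = 0")
    case True
    with less.prems(1) have "is_unit d" by (auto elim!: degree_eq_zeroE simp: is_unit_const_poly_iff dvd_field_iff)
    then show ?thesis by (rule unit_imp_dvd)
  next
    case False
    then obtain x where x: "ac_eval x d = 0" using ac_root_exists by blast
    obtain m where m: "m \<noteq> 0" "\<And>q. m dvd q \<longleftrightarrow> ac_eval x q = 0"
      using minimal_polynomial_exists[OF less.prems(1) x] by blast
    have "m dvd d" "m dvd a" using m(2) x less.prems(2) by auto
    then obtain e where e: "d = m * e" by auto
    have "degree m > 0" by (rule minimal_polynomial_degree_pos[OF m])
    with e less.prems(1) have "degree e < degree d" "e \<noteq> 0" by (auto simp: degree_mult_eq)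
    then have "e dvd a ^ degree e" using less.prems(2) e by (intro less.hyps) auto
    then have "d dvd a * a ^ degree e" unfolding e using \<open>m dvd a\<close> by (rule mult_dvd_mono[rotated])
    then show ?thesis using \<open>degree e < degree d\<close>
      by (metis Suc_leI dvd_trans le_imp_power_dvd power_Suc)
  qed
qed

subsection \<open>Roots of unity\<close>

lemma power_eq_1_iff_order_dvd:
  assumes "is_root_of_unity x"
  shows "x ^ n = 1 \<longleftrightarrow> root_of_unity_order x dvd n"
    and "root_of_unity_order x > 0"
proof -
  define m where "m = root_of_unity_order x"
  have m: "m > 0 \<and> x ^ m = 1"
    using assms unfolding m_def root_of_unity_order_def is_root_of_unity_def by (rule LeastI_ex)
  have least: "m \<le> r" if "r > 0" "x ^ r = 1" for r
    unfolding m_def root_of_unity_order_def by (rule Least_le) (use that in simp)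
  have "x ^ n = x ^ (m * (n div m) + n mod m)" by simp
  also have "\<dots> = x ^ (n mod m)" by (simp only: power_add power_mult m power_one mult_1)
  finally have eq: "x ^ n = x ^ (n mod m)" .
  have "n mod m = 0" if "x ^ n = 1"
    using least[of "n mod m"] eq that m by (metis gr_zeroI mod_less_divisor not_less)
  then show "x ^ n = 1 \<longleftrightarrow> root_of_unity_order x dvd n"
    unfolding m_def[symmetric] dvd_eq_mod_eq_0 using eq by (metis power_0)
  show "root_of_unity_order x > 0" using m by (simp add: m_def)
qed

text \<open>Dividing \<open>m\<close> repeatedly by its gcd with \<open>k\<close> removes the shared
  primes, and each division costs one factor \<open>k\<close>.\<close>

lemma exists_coprime_part:
  fixes m k :: nat
  assumes "m > 0"
  shows "\<exists>n s. n > 0 \<and> coprime n k \<and> m dvd n * k ^ s"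
  using assms
proof (induction m rule: less_induct)
  case (less m)
  show ?case
  proof (cases "coprime m k")
    case True
    with less.prems show ?thesis by (intro exI[of _ m] exI[of _ 0]) simp
  next
    case False
    define g where "g = gcd m k"
    obtain m' where m': "m = g * m'" unfolding g_def by (metis dvdE gcd_dvd1)
    have "g \<noteq> 1" "g > 0" "g dvd k" using False less.prems by (auto simp: g_def coprime_iff_gcd_eq_1)
    with m' less.prems have "m' > 0" "m' < m" by (auto intro!: gr0I)
    then obtain n s where "n > 0" "coprime n k" "m' dvd n * k ^ s" using less.IH by blast
    moreover from this have "g * m' dvd k * (n * k ^ s)" using \<open>g dvd k\<close> by (intro mult_dvd_mono) auto
    ultimately show ?thesis using m' by (intro exI[of _ n] exI[of _ "Suc s"]) (simp add: mult.left_commute)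
  qed
qed

text \<open>Coprime parts of the orders are multiplied and the exponents of \<open>k\<close> added.
  The resulting \<open>n\<close> is coprime to \<open>k\<close>, so no order in question divides
  it.\<close>

lemma common_root_of_unity_exponents:
  fixes R :: "'a::field set"
  assumes "finite R"
    and "\<And>x. x \<in> R \<Longrightarrow> is_root_of_unity x \<and> \<not> coprime (root_of_unity_order x) k"
  obtains n s :: nat where "n > 0" "\<And>x. x \<in> R \<Longrightarrow> x ^ n \<noteq> 1 \<and> x ^ (n * k ^ s) = 1"
proof -
  have "\<forall>x\<in>R. \<exists>n s. n > 0 \<and> coprime n k \<and> root_of_unity_order x dvd n * k ^ s"
    using assms(2) power_eq_1_iff_order_dvd(2) exists_coprime_part by blast
  then obtain n s where ns: "\<And>x. x \<in> R \<Longrightarrow>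
      n x > 0 \<and> coprime (n x) k \<and> root_of_unity_order x dvd n x * k ^ s x"
    by metis
  define N where "N = (\<Prod>x\<in>R. n x)"
  define S where "S = (\<Sum>x\<in>R. s x)"
  have "N > 0" using ns by (auto simp: N_def intro: prod_pos)
  have "coprime N k" unfolding N_def using ns by (intro prod_coprime_left) auto
  have "x ^ N \<noteq> 1 \<and> x ^ (N * k ^ S) = 1" if "x \<in> R" for x
  proof
    show "x ^ N \<noteq> 1"
      using power_eq_1_iff_order_dvd(1)[of x N] assms(2)[OF that] \<open>coprime N k\<close>
      by (metis coprime_divisors dvd_refl)
    have "n x * k ^ s x dvd N * k ^ S"
      unfolding N_def S_def using that assms(1)
      by (intro mult_dvd_mono le_imp_power_dvd dvd_prodI member_le_sum) auto
    then show "x ^ (N * k ^ S) = 1"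
      using power_eq_1_iff_order_dvd(1)[of x "N * k ^ S"] assms(2)[OF that] ns[OF that]
      by (metis dvd_trans)
  qed
  then show ?thesis using that \<open>N > 0\<close> by blast
qed

text \<open>The power of \<open>z\<close> absorbs the root 0 of \<open>d\<close>, and
  \<open>coeff h 0 \<noteq> 0\<close> makes \<open>h\<close> invertible as a power series.\<close>

lemma compensating_polynomial:
  fixes d :: "'a::field poly"
  assumes "k > 0" "d \<noteq> 0"
    and "\<And>x. x \<noteq> 0 \<Longrightarrow> ac_eval x d = 0 \<Longrightarrow>
      is_root_of_unity x \<and> \<not> coprime (root_of_unity_order x) k"
  obtains h p :: "'a poly" and v where "coeff h 0 \<noteq> 0" "dilate_poly k h = h * p" "d dvd monom 1 v * p"
proof -
  define R where "R = {x. x \<noteq> 0 \<and> ac_eval x d = 0}"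
  have "finite R" using finite_ac_roots[OF assms(2)] by (simp add: R_def)
  then obtain n s :: nat where ns: "n > 0" "\<And>x. x \<in> R \<Longrightarrow> x ^ n \<noteq> 1 \<and> x ^ (n * k ^ s) = 1"
    using common_root_of_unity_exponents[of R k] assms(3) unfolding R_def by blast
  define Q :: "'a poly" where "Q = (\<Sum>i<k ^ s. monom 1 n ^ i)"
  have Q: "1 - monom 1 (n * k ^ s) = (1 - monom 1 n) * Q"
    using one_diff_power_eq[of "monom 1 n :: 'a poly" "k ^ s"] by (simp add: Q_def monom_power)
  define a where "a = degree d"
  \<comment> \<open>\<open>z\<close> vanishes at 0, and \<open>Q\<close> at the other roots, which
    satisfy \<open>x ^ (n * k ^ s) = 1\<close> but not \<open>x ^ n = 1\<close>.\<close>
  have "ac_eval x (monom 1 1 * Q) = 0" if "ac_eval x d = 0" for x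
  proof (cases "x = 0")
    case False
    with that have x: "x ^ n \<noteq> 1" "x ^ (n * k ^ s) = 1" using ns by (auto simp: R_def)
    have "(1 - x ^ n) * ac_eval x Q = 1 - x ^ (n * k ^ s)"
      using arg_cong[OF Q, of "ac_eval x"] by simp
    with x show ?thesis by simp
  qed simp
  then have "d dvd (monom 1 1 * Q) ^ a"
    unfolding a_def using assms(2) by (intro dvd_power_degree_if_roots)
  then have dvd: "d dvd monom 1 a * Q ^ a" by (simp add: power_mult_distrib monom_power)
  define u :: "nat \<Rightarrow> 'a poly" where "u = (\<lambda>j. (1 - monom 1 (n * k ^ j)) ^ a)"
  define h where "h = (\<Prod>j<s. u j)"
  have dil_u: "dilate_poly k (u j) = u (Suc j)" for j
  proof -
    have "dilate_poly k (1 - monom 1 (n * k ^ j)) = (1 - monom 1 (n * k ^ Suc j) :: 'a poly)"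
      using assms(1) dilate_poly_monom[of k "1 :: 'a"]
      by (simp add: dilate_poly_def pcompose_diff pcompose_1 mult.left_commute)
    then show ?thesis by (simp add: u_def dilate_poly_power)
  qed
  have dil_h: "dilate_poly k (\<Prod>j<i. u j) = (\<Prod>j<i. u (Suc j))" for i
    by (induction i) (simp_all add: dilate_poly_mult dil_u, simp add: dilate_poly_def pcompose_1)
  \<comment> \<open>Dilation shifts the index of \<open>u\<close>, so the quotient telescopes:
    \<open>h(z^k) / h(z) = u s / u 0\<close>.\<close>
  have "u 0 * dilate_poly k h = (\<Prod>j<Suc s. u j)"
    unfolding h_def dil_h by (simp add: prod.lessThan_Suc_shift del: prod.lessThan_Suc)
  also have "\<dots> = h * u s" by (simp add: h_def)
  also have "u s = u 0 * Q ^ a" using Q by (simp add: u_def power_mult_distrib)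
  finally have "u 0 * dilate_poly k h = u 0 * (h * Q ^ a)" by (simp add: mult_ac)
  moreover have u0: "poly (u j) 0 = 1" for j
    using ns(1) assms(1) by (simp add: u_def poly_monom power_0_left)
  have "u 0 \<noteq> 0" using u0[of 0] by auto
  ultimately have "dilate_poly k h = h * Q ^ a" by simp
  moreover have "coeff h 0 \<noteq> 0"
    by (simp add: h_def poly_prod u0 flip: poly_0_coeff_0)
  ultimately show ?thesis using dvd that by blast
qed

subsection \<open>Sufficiency\<close>

text \<open>Since \<open>h\<close> divides \<open>h(z^k)\<close> and dilation preserves
  divisibility, the successive dilates of \<open>h\<close> form a divisibility chain starting from
  \<open>h(z^k) = h p\<close>.\<close>

lemma mult_dvd_dilate_poly_power:
  fixes h p :: "'a::field poly"
  assumes "dilate_poly k h = h * p" "k > 0" "i > 0"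
  shows "h * p dvd dilate_poly (k ^ i) h"
proof -
  have "h * p dvd dilate_poly (k ^ Suc j) h" for j
  proof (induction j)
    case (Suc j)
    have "h * p dvd dilate_poly k h * dilate_poly k p" by (simp add: assms(1))
    also have "\<dots> = dilate_poly k (h * p)" by (simp add: dilate_poly_mult)
    also have "\<dots> dvd dilate_poly k (dilate_poly (k ^ Suc j) h)" by (intro dilate_poly_dvd Suc.IH)
    finally show ?case using assms(2) by (simp add: dilate_poly_dilate_poly)
  qed (simp add: assms(1))
  from this[of "i - 1"] show ?thesis using assms(3) by simp
qed

text \<open>With \<open>f = h g\<close>, each \<open>g(z^(k^i))\<close> carries the factor
  \<open>h(z^(k^i))\<close>, which \<open>h p\<close> divides for \<open>i \<ge> 1\<close>. This
  common factor is later cancelled.\<close>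

lemma mahler_module_mult_compensator:
  fixes h p :: "'a::field poly"
  assumes "dilate_poly k h = h * p" "k > 0"
    and "x \<in> mahler_module k (fps_of_poly h * g) (Suc 0)"
  shows "\<exists>y \<in> mahler_module k g (Suc 0). x = fps_of_poly (h * p) * y"
  using assms(3)
proof induction
  case zero
  then show ?case by (intro bexI[of _ 0]) (auto intro: mahler_module.zero)
next
  case (step i x q)
  then obtain y where y: "y \<in> mahler_module k g (Suc 0)" "x = fps_of_poly (h * p) * y" by blast
  have "h * p dvd dilate_poly (k ^ i) h"
    using assms step.hyps(1) by (intro mult_dvd_dilate_poly_power) auto
  then obtain w where "dilate_poly (k ^ i) h = h * p * w" by auto
  then have "dilate (k ^ i) (fps_of_poly h) = fps_of_poly (h * p * w)"
    using assms(2) fps_of_poly_dilate_poly[of "k ^ i" h] by simp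
  then have "fps_of_poly q * dilate (k ^ i) (fps_of_poly h * g) + x =
      fps_of_poly (h * p) * (fps_of_poly (q * w) * dilate (k ^ i) g + y)"
    using assms(2) by (simp add: y(2) dilate_mult fps_of_poly_mult algebra_simps)
  moreover have "fps_of_poly (q * w) * dilate (k ^ i) g + y \<in> mahler_module k g (Suc 0)"
    using step.hyps(1) y(1) by (intro mahler_module.step) auto
  ultimately show ?case by blast
qed

text \<open>For \<open>i \<ge> 1\<close> the factor \<open>z^v\<close> becomes
  \<open>z^(k^i v)\<close> with \<open>k^i \<ge> 2\<close>. Of the resulting \<open>z^(2 v)\<close>,
  one half pays for the denominator \<open>z^v\<close> of the series, the other for the
  \<open>z^v\<close> in front of \<open>G\<close>.\<close>

lemma mahler_module_split_head:
  fixes P :: "'a::field poly"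
  assumes "k \<ge> 2" "x \<in> mahler_module k (fps_of_poly P + fps_X ^ v * G) (Suc 0)"
  shows "\<exists>y \<in> mahler_module k G (Suc 0). \<exists>r. x = fps_X ^ (2 * v) * y + fps_of_poly r"
  using assms(2)
proof induction
  case zero
  then show ?case by (intro bexI[of _ 0] exI[of _ 0]) (auto intro: mahler_module.zero)
next
  case (step i x q)
  then obtain y r where y: "y \<in> mahler_module k G (Suc 0)" "x = fps_X ^ (2 * v) * y + fps_of_poly r" by blast
  have "k \<le> k ^ i" using assms(1) step.hyps(1) by (intro self_le_power) auto
  with assms(1) have "2 * v \<le> k ^ i * v" by (intro mult_right_mono) auto
  then obtain t where t: "k ^ i * v = 2 * v + t" by (auto simp: le_iff_add)
  have X: "dilate (k ^ i) (fps_X ^ v :: 'a fps) = fps_X ^ (2 * v) * fps_X ^ t"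
    using assms(1) by (simp add: dilate_fps_X_power t power_add)
  have "fps_of_poly q * dilate (k ^ i) (fps_of_poly P + fps_X ^ v * G) + x =
    fps_X ^ (2 * v) * (fps_of_poly (q * monom 1 t) * dilate (k ^ i) G + y) +
      fps_of_poly (q * dilate_poly (k ^ i) P + r)"
    using assms(1)
    by (simp add: y(2) dilate_add dilate_mult X fps_of_poly_mult
        fps_of_poly_add fps_of_poly_monom' fps_of_poly_dilate_poly algebra_simps)
  moreover have "fps_of_poly (q * monom 1 t) * dilate (k ^ i) G + y \<in> mahler_module k G (Suc 0)"
    using step.hyps(1) y(1) by (intro mahler_module.step) auto
  ultimately show ?case by blast
qed

section \<open>Regularity from an equation with leading coefficient 1\<close>

lemma fps_nth_add_fun: "fps_nth (x + y) = fps_nth x + fps_nth y"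
  by (simp add: fun_eq_iff)

lemma fps_nth_sum_fun: "fps_nth (\<Sum>i\<in>A. x i) = (\<Sum>i\<in>A. fps_nth (x i))"
  by (induction A rule: infinite_finite_induct) (simp_all add: fun_eq_iff)

text \<open>As \<open>G\<close> has coefficient 1, substituting its equation creates no
  denominators, only coefficients of degree at most \<open>2 * D\<close>; a Cartier operator with
  \<open>k \<ge> 2\<close> brings these back to degree \<open>D\<close>.\<close>

lemma k_regular_of_becker_equation:
  fixes G :: "'a::field fps"
  assumes "k \<ge> 2" and G: "G = y + fps_of_poly R" "y \<in> mahler_module k G (Suc 0)"
  shows "k_regular k (fps_of_poly A * G + fps_of_poly B)"
proof -
  obtain n q where y: "y = (\<Sum>i=1..n. fps_of_poly (q i) * dilate (k ^ i) G)"
    using mahler_module_Suc_0_repr[OF G(2)] by blast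
  define D where "D = Max (degree ` ({A, B, R} \<union> q ` {1..n}))"
  have deg: "degree p \<le> D" if "p \<in> {A, B, R} \<union> q ` {1..n}" for p
    unfolding D_def using that by (intro Max_ge) auto
  \<comment> \<open>The element 1 carries the polynomial terms, and \<open>i = 0\<close> gives
    \<open>G\<close> itself.\<close>
  define Y where "Y = insert 1 ((\<lambda>i. dilate (k ^ i) G) ` {..n})"
  define S where "S = (\<lambda>(j, x). fps_nth (fps_X ^ j * x)) ` ({..D} \<times> Y)"
  have "finite S" by (simp add: S_def Y_def)
  have poly_mult: "fps_nth (fps_of_poly p * x) \<in> seq.span S" if "degree p \<le> D" "x \<in> Y" for p x
  proof -
    have "fps_nth (fps_of_poly p * x) = (\<Sum>j\<le>degree p. seq_scale (coeff p j) (fps_nth (fps_X ^ j * x)))"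
    proof -
      have "fps_of_poly p * x = (\<Sum>j\<le>degree p. fps_const (coeff p j) * (fps_X ^ j * x))"
        by (subst poly_as_sum_of_monoms[of p, symmetric])
          (simp add: fps_of_poly_sum fps_of_poly_monom sum_distrib_right mult.assoc)
      moreover have "fps_nth (fps_const c * z) = seq_scale c (fps_nth z)" for c and z :: "'a fps"
        by (simp add: seq_scale_def fun_eq_iff)
      ultimately show ?thesis by (simp add: fps_nth_sum_fun)
    qed
    also have "\<dots> \<in> seq.span S"
      using that by (intro seq.span_sum seq.span_scale seq.span_base) (auto simp: S_def)
    finally show ?thesis .
  qed
  have Y1: "1 \<in> Y" and Yi: "i \<le> n \<Longrightarrow> dilate (k ^ i) G \<in> Y" for i by (auto simp: Y_def)
  have half: "degree (cartier_poly k r p) \<le> D" if "degree p \<le> 2 * D" for r p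
  proof -
    have "degree (cartier_poly k r p) \<le> degree p div k" using assms(1) by (intro degree_cartier_poly) auto
    also have "\<dots> \<le> (2 * D) div 2" using that assms(1) by (meson div_le_mono div_le_mono2 le_trans zero_less_numeral)
    finally show ?thesis by simp
  qed
  have pd: "fps_nth (cartier k r (fps_of_poly p * dilate (k ^ i) G)) \<in> seq.span S"
    if "degree p \<le> 2 * D" "i \<in> {1..n}" "r < k" for p i r
  proof -
    have "dilate (k ^ i) G = dilate k (dilate (k ^ (i - 1)) G)"
      using assms(1) that(2) by (simp add: dilate_dilate flip: power_Suc)
    then have "cartier k r (fps_of_poly p * dilate (k ^ i) G) =
        fps_of_poly (cartier_poly k r p) * dilate (k ^ (i - 1)) G"
      using that(3) by (simp add: cartier_poly_mult_dilate)
    moreover have "i - 1 \<le> n" using that(2) by auto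
    ultimately show ?thesis using poly_mult[OF half[OF that(1)] Yi] by (simp del: cartier_nth)
  qed
  have pc: "fps_nth (cartier k r (fps_of_poly p)) \<in> seq.span S" if "degree p \<le> 2 * D" for p r
    using poly_mult[OF half[OF that] Y1] assms(1)
    by (simp add: fps_of_poly_cartier_poly del: cartier_nth)
  have gen: "fps_nth (cartier k r (fps_X ^ j * x)) \<in> seq.span S" if "j \<le> D" "x \<in> Y" "r < k" for j x r
  proof -
    have degj: "degree (monom 1 j * p) \<le> 2 * D" if "degree p \<le> D" for p :: "'a poly"
      using that \<open>j \<le> D\<close> degree_mult_le[of "monom 1 j" p] degree_monom_le[of "1::'a" j] by linarith
    have deg1: "degree (monom (1::'a) j) \<le> 2 * D" using degj[of 1] by simp
    consider "x = 1" | i where "i \<in> {1..n}" "x = dilate (k ^ i) G" | "x = G"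
    proof -
      have "x = 1 \<or> (\<exists>i\<le>n. x = dilate (k ^ i) G)" using \<open>x \<in> Y\<close> by (auto simp: Y_def)
      moreover have "x = G \<or> i \<in> {1..n}" if "x = dilate (k ^ i) G" "i \<le> n" for i
        using that by (cases "i = 0") auto
      ultimately show ?thesis using that by blast
    qed
    then show ?thesis
    proof cases
      case 1
      with pc[OF deg1, of r] show ?thesis by (simp add: fps_of_poly_monom' del: cartier_nth)
    next
      case 2
      with pd[OF deg1, of i r] that(3) show ?thesis by (simp add: fps_of_poly_monom' del: cartier_nth)
    next
      case 3
      \<comment> \<open>\<open>G\<close> is not a dilate to which the Cartier operator could be
        applied directly, so its equation is inserted first.\<close>
      have "fps_X ^ j * x = (\<Sum>i=1..n. fps_of_poly (monom 1 j * q i) * dilate (k ^ i) G) +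
          fps_of_poly (monom 1 j * R)"
        unfolding 3
        by (subst G(1), subst y)
          (simp add: fps_of_poly_mult fps_of_poly_monom' distrib_left sum_distrib_left mult.assoc)
      then have "fps_nth (cartier k r (fps_X ^ j * x)) =
        (\<Sum>i=1..n. fps_nth (cartier k r (fps_of_poly (monom 1 j * q i) * dilate (k ^ i) G))) +
          fps_nth (cartier k r (fps_of_poly (monom 1 j * R)))"
        by (simp only: cartier_add cartier_sum fps_nth_add_fun fps_nth_sum_fun)
      also have "\<dots> \<in> seq.span S"
        using that(3) by (intro seq.span_add seq.span_sum pd pc degj deg) auto
      finally show ?thesis .
    qed
  qed
  have closed: "fps_nth (cartier k r x) \<in> seq.span S" if "fps_nth x \<in> seq.span S" "r < k" for x r
  proof -
    let ?T = "{a. fps_nth (cartier k r (Abs_fps a)) \<in> seq.span S}"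
    have "seq.subspace ?T"
    proof (rule seq.subspaceI)
      have "Abs_fps 0 = (0 :: 'a fps)" by (simp add: fps_eq_iff)
      moreover have "fps_nth 0 = (0 :: nat \<Rightarrow> 'a)" by (simp add: fun_eq_iff)
      ultimately show "0 \<in> ?T" using seq.span_zero by (simp del: cartier_nth)
    next
      fix a b assume "a \<in> ?T" "b \<in> ?T"
      moreover have "Abs_fps (a + b) = Abs_fps a + Abs_fps b" by (simp add: fps_eq_iff)
      ultimately show "a + b \<in> ?T"
        using seq.span_add by (simp add: cartier_add fps_nth_add_fun del: cartier_nth)
    next
      fix c a assume "a \<in> ?T"
      moreover have "fps_nth (cartier k r (Abs_fps (seq_scale c a))) = seq_scale c (fps_nth (cartier k r (Abs_fps a)))"
        by (simp add: fun_eq_iff seq_scale_def)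
      ultimately show "seq_scale c a \<in> ?T" using seq.span_scale by (simp del: cartier_nth)
    qed
    moreover have "S \<subseteq> ?T" using gen[OF _ _ that(2)] by (auto simp: S_def fps_nth_inverse simp del: cartier_nth)
    ultimately have "seq.span S \<subseteq> ?T" by (rule seq.span_minimal[rotated])
    with that(1) have "fps_nth x \<in> ?T" by blast
    then show ?thesis by (simp add: fps_nth_inverse del: cartier_nth)
  qed
  have "fps_nth (fps_of_poly A * G + fps_of_poly B) \<in> seq.span S"
    using seq.span_add[OF poly_mult[OF deg Yi[of 0]] poly_mult[OF deg Y1], of A B]
    by (simp add: fps_nth_add_fun)
  then show ?thesis using \<open>finite S\<close> closed by (intro k_regularI)
qed

text \<open>The equation passes from \<open>f\<close> to \<open>g = f / h\<close>, whose leading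
  coefficient is a power of \<open>z\<close>, and then to the tail \<open>G\<close> of
  \<open>g\<close>, where it is 1.\<close>

lemma k_regular_if_roots:
  fixes f :: "'a::field fps"
  assumes "k \<ge> 2" "is_mahler k f"
    and "\<And>x. x \<noteq> 0 \<Longrightarrow> ac_eval x (mahler_denominator k f) = 0 \<Longrightarrow>
      is_root_of_unity x \<and> \<not> coprime (root_of_unity_order x) k"
  shows "k_regular k f"
proof -
  define d where "d = mahler_denominator k f"
  have "k > 0" using assms(1) by simp
  have "d \<noteq> 0" using mahler_denominator_nonzero[OF assms(2)] by (simp add: d_def)
  then obtain h p :: "'a poly" and v where hp: "coeff h 0 \<noteq> 0" "dilate_poly k h = h * p" "d dvd monom 1 v * p"
    using compensating_polynomial[OF \<open>k > 0\<close>, of d] assms(3) unfolding d_def by blast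
  then obtain w where w: "monom 1 v * p = d * w" by auto
  have "h \<noteq> 0" using hp(1) by auto
  then have "h * p \<noteq> 0" using hp(2) \<open>k > 0\<close> by (metis dilate_poly_eq_0_iff)
  define g where "g = inverse (fps_of_poly h) * f"
  have f: "f = fps_of_poly h * g"
    using hp(1) inverse_mult_eq_1'[of "fps_of_poly h"] by (simp add: g_def mult.assoc[symmetric])
  have "fps_of_poly d * f \<in> mahler_module k f (Suc 0)"
    using mahler_denominator_dvd_iff[OF assms(2), of d] by (simp add: d_def)
  then obtain y where y: "y \<in> mahler_module k g (Suc 0)" "fps_of_poly d * f = fps_of_poly (h * p) * y"
    using mahler_module_mult_compensator[OF hp(2) \<open>k > 0\<close>] unfolding f by blast
  \<comment> \<open>Both sides of the equation contain \<open>h * p\<close>; cancelling it leaves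
    \<open>z^v\<close> as the coefficient of \<open>g\<close>.\<close>
  have "fps_of_poly (h * p) * (fps_X ^ v * g) = fps_of_poly (monom 1 v * p) * (fps_of_poly h * g)"
    by (simp add: fps_of_poly_mult fps_of_poly_monom' mult_ac)
  also have "\<dots> = fps_of_poly (h * p) * (fps_of_poly w * y)"
    using y(2) unfolding w f[symmetric] by (simp add: fps_of_poly_mult mult_ac)
  finally have "fps_X ^ v * g = fps_of_poly w * y"
    using \<open>h * p \<noteq> 0\<close> by (simp add: fps_of_poly_eq_iff[of _ 0, simplified])
  then have vg: "fps_X ^ v * g \<in> mahler_module k g (Suc 0)"
    using y(1) by (simp add: mahler_module_mult)
  define P where "P = truncate_fps v g"
  define G where "G = fps_shift v g"
  have g: "g = fps_of_poly P + fps_X ^ v * G"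
    by (simp add: P_def G_def fps_eq_iff fps_X_power_mult_nth)
  obtain y r where yr: "y \<in> mahler_module k G (Suc 0)" "fps_X ^ v * g = fps_X ^ (2 * v) * y + fps_of_poly r"
    using mahler_module_split_head[OF assms(1), of _ P v G] vg unfolding g[symmetric] by blast
  \<comment> \<open>The shift is an exact division: as a power series, \<open>r - z^v P\<close>
    equals \<open>z^(2 v) (G - y)\<close>.\<close>
  define R where "R = poly_shift (2 * v) (r - monom 1 v * P)"
  have "fps_X ^ v * fps_of_poly P + fps_X ^ (2 * v) * G = fps_X ^ (2 * v) * y + fps_of_poly r"
    using yr(2) by (subst (asm) g) (simp add: distrib_left mult_2 power_add mult.assoc)
  then have "fps_X ^ (2 * v) * (G - y) = fps_of_poly (r - monom 1 v * P)"
    by (simp add: fps_of_poly_diff fps_of_poly_mult fps_of_poly_monom' algebra_simps)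
  then have "fps_of_poly R = fps_shift (2 * v) (fps_X ^ (2 * v) * (G - y))"
    by (simp add: R_def)
  also have "\<dots> = G - y" by (simp add: fps_eq_iff fps_X_power_mult_nth)
  finally have "G = y + fps_of_poly R" by simp
  from k_regular_of_becker_equation[OF assms(1) this yr(1), of "h * monom 1 v" "h * P"]
  have "k_regular k (fps_of_poly (h * monom 1 v) * G + fps_of_poly (h * P))" .
  also have "fps_of_poly (h * monom 1 v) * G + fps_of_poly (h * P) = f"
    by (subst f, subst g) (simp add: fps_of_poly_mult fps_of_poly_monom' algebra_simps)
  finally show ?thesis .
qed

subsection \<open>Necessity\<close>

text \<open>
  Attach to each drop \<open>j\<close> the largest \<open>i\<close> such that \<open>m\<^sup>i L\<^sub>0\<close> contains a witness of the drop. Infinitely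
  many drops share the same \<open>i\<close>; in a relation between more than \<open>n\<close> of their witnesses, the first term with a
  coefficient prime to \<open>m\<close> can be traded for a witness in \<open>m\<^sup>i\<^sup>+\<^sup>1 L\<^sub>0\<close>.
\<close>

lemma descending_chain_stabilizes:
  fixes L :: "nat \<Rightarrow> 'a::field fps set"
  assumes m: "\<And>q. m dvd q \<longleftrightarrow> ac_eval x q = 0"
    and zero: "\<And>j. 0 \<in> L j"
    and add: "\<And>j y z. y \<in> L j \<Longrightarrow> z \<in> L j \<Longrightarrow> y + z \<in> L j"
    and mult: "\<And>j y q. y \<in> L j \<Longrightarrow> fps_of_poly q * y \<in> L j"
    and anti: "\<And>i j. i \<le> j \<Longrightarrow> L j \<subseteq> L i"
    and sat: "\<And>j y u. ac_eval x u \<noteq> 0 \<Longrightarrow> fps_of_poly u * y \<in> L j \<Longrightarrow> y \<in> L j"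
    and bound: "\<And>j y. y \<in> L 0 \<Longrightarrow> fps_of_poly (m ^ b) * y \<in> L j"
    and rank: "\<And>(A :: nat set) y. finite A \<Longrightarrow> card A > n \<Longrightarrow> y ` A \<subseteq> L 0 \<Longrightarrow>
      \<exists>p. (\<exists>l\<in>A. ac_eval x (p l) \<noteq> 0) \<and> (\<Sum>l\<in>A. fps_of_poly (p l) * y l) = 0"
  shows "finite {j. L (Suc j) \<noteq> L j}"
proof (rule ccontr)
  define J where "J = {j. L (Suc j) \<noteq> L j}"
  assume "infinite {j. L (Suc j) \<noteq> L j}"
  then have "infinite J" by (simp add: J_def)
  have uminus: "- y \<in> L j" if "y \<in> L j" for y j
    using mult[OF that, of "-1"] by (simp add: fps_of_poly_uminus)
  have sum: "(\<Sum>i\<in>A. y i) \<in> L j" if "\<And>i. i \<in> A \<Longrightarrow> y i \<in> L j" for A j and y :: "nat \<Rightarrow> _"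
    using that by (induction A rule: infinite_finite_induct) (auto intro: zero add)
  define P where "P = (\<lambda>j i. \<exists>y\<in>L 0. fps_of_poly (m ^ i) * y \<in> L j - L (Suc j))"
  define i where "i = (\<lambda>j. GREATEST i. P j i)"
  \<comment> \<open>\<open>bound\<close> caps the exponents, so a greatest one exists.\<close>
  have Pb: "i \<le> b" if ji: "P j i" for i j
  proof (rule ccontr)
    assume "\<not> i \<le> b"
    then have "m ^ i = m ^ b * m ^ (i - b)" by (simp flip: power_add)
    obtain y where y: "y \<in> L 0" "fps_of_poly (m ^ i) * y \<notin> L (Suc j)" using ji by (auto simp: P_def)
    have "fps_of_poly (m ^ b) * (fps_of_poly (m ^ (i - b)) * y) \<in> L (Suc j)"
      using y(1) by (intro bound mult)
    with y(2) \<open>m ^ i = _\<close> show False by (simp add: fps_of_poly_mult mult.assoc)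
  qed
  have P0: "P j 0" if "j \<in> J" for j
    using that anti[of j "Suc j"] anti[of 0 j] by (auto simp: J_def P_def)
  have Pi: "P j (i j)" if "j \<in> J" for j
    unfolding i_def using P0[OF that] Pb by (rule GreatestI_nat)
  have "i ` J \<subseteq> {..b}" using Pi Pb by auto
  then obtain j0 where "infinite {j\<in>J. i j = i j0}"
    using pigeonhole_infinite[OF \<open>infinite J\<close>, of i] finite_subset by blast
  then obtain A where A: "A \<subseteq> {j\<in>J. i j = i j0}" "finite A" "card A = Suc n"
    using infinite_arbitrarily_large by blast
  define i0 where "i0 = i j0"
  have "\<forall>j\<in>A. \<exists>y\<in>L 0. fps_of_poly (m ^ i0) * y \<in> L j - L (Suc j)"
    using A Pi unfolding P_def i0_def by force
  then obtain y where y: "\<And>j. j \<in> A \<Longrightarrow> y j \<in> L 0"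
    "\<And>j. j \<in> A \<Longrightarrow> fps_of_poly (m ^ i0) * y j \<in> L j"
    "\<And>j. j \<in> A \<Longrightarrow> fps_of_poly (m ^ i0) * y j \<notin> L (Suc j)" by (metis DiffE)
  obtain p where p: "\<exists>l\<in>A. ac_eval x (p l) \<noteq> 0" "(\<Sum>l\<in>A. fps_of_poly (p l) * y l) = 0"
    using rank[of A y] A y(1) by auto
  \<comment> \<open>Terms before \<open>l\<close> have coefficients divisible by \<open>m\<close>;
    terms after \<open>l\<close> lie in \<open>L (Suc l)\<close> once multiplied by
    \<open>m ^ i0\<close>.\<close>
  define l where "l = Min {j\<in>A. ac_eval x (p j) \<noteq> 0}"
  have "l \<in> {j\<in>A. ac_eval x (p j) \<noteq> 0}" unfolding l_def using A p(1) by (intro Min_in) auto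
  then have l: "l \<in> A" "ac_eval x (p l) \<noteq> 0" by auto
  have "m dvd p j" if "j \<in> A" "j < l" for j
  proof (rule ccontr)
    assume "\<not> m dvd p j"
    then have "l \<le> j" unfolding l_def using that(1) A(2) by (intro Min_le) (auto simp: m)
    with that(2) show False by simp
  qed
  then have "\<forall>j\<in>{j\<in>A. j < l}. \<exists>q. p j = m * q" by auto
  then obtain q where q: "\<And>j. j \<in> A \<Longrightarrow> j < l \<Longrightarrow> p j = m * q j" by (metis (lifting) mem_Collect_eq)
  define s where "s = (\<Sum>j\<in>{j\<in>A. j < l}. fps_of_poly (q j) * y j)"
  define t where "t = (\<Sum>j\<in>{j\<in>A. j > l}. fps_of_poly (p j) * (fps_of_poly (m ^ i0) * y j))"
  define yl where "yl = fps_of_poly (m ^ i0) * y l"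
  have "A = {j\<in>A. j < l} \<union> ({j\<in>A. j > l} \<union> {l})" using l(1) by auto
  then have "(\<Sum>j\<in>A. fps_of_poly (p j) * y j) =
    (\<Sum>j\<in>{j\<in>A. j < l} \<union> ({j\<in>A. j > l} \<union> {l}). fps_of_poly (p j) * y j)" by simp
  also have "\<dots> = (\<Sum>j\<in>{j\<in>A. j < l}. fps_of_poly (p j) * y j) +
    ((\<Sum>j\<in>{j\<in>A. j > l}. fps_of_poly (p j) * y j) + fps_of_poly (p l) * y l)"
    using A(2) by (subst sum.union_disjoint, simp, simp, force)+ simp
  also have "(\<Sum>j\<in>{j\<in>A. j < l}. fps_of_poly (p j) * y j) = fps_of_poly m * s"
    unfolding s_def sum_distrib_left by (rule sum.cong) (auto simp: q fps_of_poly_mult mult.assoc)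
  finally have "0 = fps_of_poly (m ^ i0) * (fps_of_poly m * s +
    ((\<Sum>j\<in>{j\<in>A. j > l}. fps_of_poly (p j) * y j) + fps_of_poly (p l) * y l))"
    using p(2) by simp
  also have "\<dots> = fps_of_poly (m ^ Suc i0) * s + (t + fps_of_poly (p l) * yl)"
    by (simp add: t_def yl_def sum_distrib_left fps_of_poly_mult algebra_simps)
  finally have rel: "fps_of_poly (m ^ Suc i0) * s + (t + fps_of_poly (p l) * yl) = 0" by simp
  have s: "s \<in> L 0" unfolding s_def using y(1) by (intro sum mult) auto
  have t: "t \<in> L (Suc l)"
    unfolding t_def
  proof (intro sum mult[of "fps_of_poly (m ^ i0) * _"])
    fix j assume "j \<in> {j\<in>A. j > l}"
    then show "fps_of_poly (m ^ i0) * y j \<in> L (Suc l)" using y(2)[of j] anti[of "Suc l" j] by auto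
  qed
  have yl: "yl \<in> L l" "yl \<notin> L (Suc l)" using y l(1) by (auto simp: yl_def)
  have "fps_of_poly (m ^ Suc i0) * s = - (t + fps_of_poly (p l) * yl)"
    by (rule iffD2[OF eq_neg_iff_add_eq_0, OF rel])
  moreover have "t \<in> L l" using t anti[of l "Suc l"] by auto
  ultimately have in_l: "fps_of_poly (m ^ Suc i0) * s \<in> L l"
    using yl(1) by (simp only:) (intro uminus add mult)
  \<comment> \<open>Otherwise \<open>p l\<close> times \<open>yl\<close> would lie in
    \<open>L (Suc l)\<close>, and by saturation \<open>yl\<close> as well, since \<open>p l\<close>
    is nonzero at \<open>x\<close>.\<close>
  have "fps_of_poly (m ^ Suc i0) * s \<notin> L (Suc l)"
  proof
    assume "fps_of_poly (m ^ Suc i0) * s \<in> L (Suc l)"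
    then have "- (fps_of_poly (m ^ Suc i0) * s + t) \<in> L (Suc l)" using t by (intro uminus add)
    moreover have "- (fps_of_poly (m ^ Suc i0) * s + t) = fps_of_poly (p l) * yl"
      unfolding neg_eq_iff_add_eq_0 using rel by (simp only: add.assoc)
    ultimately show False using sat[OF l(2)] yl(2) by simp
  qed
  with in_l s have "P l (Suc i0)" by (auto simp: P_def)
  then have "Suc i0 \<le> i l" unfolding i_def using Pb by (rule Greatest_le_nat)
  moreover have "i l = i0" using l(1) A(1) by (auto simp: i0_def)
  ultimately show False by simp
qed

text \<open>The Mahler equation expresses the dilate of index \<open>n\<close> rationally by the
  earlier ones, and dilating such a relation advances its index by one.\<close>

lemma mahler_module_rational_rank:
  fixes f :: "'a::field fps"
  assumes "is_mahler k f" "k > 0"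
  obtains n where "\<And>y. y \<in> mahler_module k f 0 \<Longrightarrow>
    \<exists>s a. s \<noteq> 0 \<and> fps_of_poly s * y = (\<Sum>l<n. fps_of_poly (a l) * dilate (k ^ l) f)"
proof -
  obtain n p where p: "p 0 * p n \<noteq> 0" "(\<Sum>i=0..n. fps_of_poly (p i) * dilate (k ^ i) f) = 0"
    using assms(1) unfolding is_mahler_def dilate_def by blast
  define T where "T = {y. \<exists>s a. s \<noteq> 0 \<and> fps_of_poly s * y = (\<Sum>l<n. fps_of_poly (a l) * dilate (k ^ l) f)}"
  have TI: "y \<in> T" if "s \<noteq> 0" "fps_of_poly s * y = (\<Sum>l<n. fps_of_poly (a l) * dilate (k ^ l) f)" for y s a
    using that unfolding T_def by blast
  have add: "y + z \<in> T" if "y \<in> T" "z \<in> T" for y z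
  proof -
    obtain s a where 1: "s \<noteq> 0" "fps_of_poly s * y = (\<Sum>l<n. fps_of_poly (a l) * dilate (k ^ l) f)"
      using \<open>y \<in> T\<close> unfolding T_def by blast
    obtain s' a' where 2: "s' \<noteq> 0" "fps_of_poly s' * z = (\<Sum>l<n. fps_of_poly (a' l) * dilate (k ^ l) f)"
      using \<open>z \<in> T\<close> unfolding T_def by blast
    have "fps_of_poly (s * s') * (y + z) =
        fps_of_poly s' * (fps_of_poly s * y) + fps_of_poly s * (fps_of_poly s' * z)"
      by (simp add: fps_of_poly_mult algebra_simps)
    also have "\<dots> = (\<Sum>l<n. fps_of_poly (s' * a l + s * a' l) * dilate (k ^ l) f)"
      unfolding 1(2) 2(2) sum_distrib_left sum.distrib[symmetric]
      by (rule sum.cong) (auto simp: fps_of_poly_mult fps_of_poly_add algebra_simps)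
    finally show ?thesis using 1(1) 2(1) by (intro TI[of "s * s'"]) auto
  qed
  have mult: "fps_of_poly r * y \<in> T" if y: "y \<in> T" for r y
  proof -
    obtain s a where 1: "s \<noteq> 0" "fps_of_poly s * y = (\<Sum>l<n. fps_of_poly (a l) * dilate (k ^ l) f)"
      using y unfolding T_def by blast
    have "fps_of_poly s * (fps_of_poly r * y) = fps_of_poly r * (fps_of_poly s * y)"
      by (simp add: mult_ac)
    also have "\<dots> = (\<Sum>l<n. fps_of_poly (r * a l) * dilate (k ^ l) f)"
      unfolding 1(2) sum_distrib_left by (rule sum.cong) (auto simp: fps_of_poly_mult mult.assoc)
    finally show ?thesis using 1(1) by (rule TI[rotated])
  qed
  have div: "y \<in> T" if ry: "fps_of_poly r * y \<in> T" "r \<noteq> 0" for r y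
  proof -
    obtain s a where "s \<noteq> 0" "fps_of_poly s * (fps_of_poly r * y) = (\<Sum>l<n. fps_of_poly (a l) * dilate (k ^ l) f)"
      using ry(1) unfolding T_def by blast
    with ry(2) show ?thesis by (intro TI[of "s * r"]) (auto simp: fps_of_poly_mult mult.assoc)
  qed
  have zero: "0 \<in> T" by (rule TI[of 1 _ "\<lambda>_. 0"]) auto
  have sum: "(\<Sum>l\<in>A. y l) \<in> T" if "\<And>l. l \<in> A \<Longrightarrow> y l \<in> T" for A and y :: "nat \<Rightarrow> _"
    using that by (induction A rule: infinite_finite_induct) (auto intro: zero add)
  have lt: "dilate (k ^ i) f \<in> T" if "i < n" for i
  proof (rule TI)
    have "(\<Sum>l<n. fps_of_poly (if l = i then 1 else 0) * dilate (k ^ l) f) =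
      (\<Sum>l<n. if l = i then dilate (k ^ i) f else 0)" by (rule sum.cong) auto
    with that show "fps_of_poly 1 * dilate (k ^ i) f =
      (\<Sum>l<n. fps_of_poly (if l = i then 1 else 0) * dilate (k ^ l) f)" by simp
  qed simp
  have "{0..n} = insert n {..<n}" by auto
  with p(2) have "fps_of_poly (p n) * dilate (k ^ n) f = (\<Sum>l<n. fps_of_poly (- p l) * dilate (k ^ l) f)"
    by (simp add: fps_of_poly_uminus sum_negf eq_neg_iff_add_eq_0)
  then have eq: "dilate (k ^ n) f \<in> T" using p(1) by (intro TI[of "p n"]) auto
  have le: "dilate (k ^ i) f \<in> T" if "i \<le> n" for i using that lt eq by (cases "i = n") auto
  have all: "dilate (k ^ i) f \<in> T" for i
  proof (induction i)
    case 0
    show ?case by (rule le) simp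
  next
    case (Suc i)
    then obtain s a where 1: "s \<noteq> 0"
      "fps_of_poly s * dilate (k ^ i) f = (\<Sum>l<n. fps_of_poly (a l) * dilate (k ^ l) f)"
      unfolding T_def by blast
    \<comment> \<open>Dilation moves the indices \<open>l < n\<close> to
      \<open>Suc l \<le> n\<close>, which \<open>le\<close> covers.\<close>
    have "fps_of_poly (dilate_poly k s) * dilate (k ^ Suc i) f =
        (\<Sum>l<n. fps_of_poly (dilate_poly k (a l)) * dilate (k ^ Suc l) f)"
      using arg_cong[OF 1(2), of "dilate k"] assms(2)
      by (simp add: dilate_mult dilate_sum dilate_dilate fps_of_poly_dilate_poly)
    also have "\<dots> \<in> T" by (intro sum mult le) auto
    finally have "fps_of_poly (dilate_poly k s) * dilate (k ^ Suc i) f \<in> T" .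
    then show ?case by (rule div) (use 1(1) assms(2) in simp)
  qed
  have "y \<in> T" if "y \<in> mahler_module k f 0" for y
    using that by induction (auto intro: zero add mult all)
  then show ?thesis using that[of n] unfolding T_def by blast
qed

text \<open>While \<open>m\<close> divides all coefficients it can be cancelled. The degree of the
  nonzero coefficient at \<open>t\<close> drops each time, so this ends.\<close>

lemma relation_not_all_divisible:
  fixes y :: "'b \<Rightarrow> 'a::field fps"
  assumes m: "m \<noteq> 0" "\<And>q. m dvd q \<longleftrightarrow> ac_eval x q = 0"
    and "t \<in> A" "p t \<noteq> 0" "(\<Sum>l\<in>A. fps_of_poly (p l) * y l) = 0"
  shows "\<exists>p. (\<exists>l\<in>A. ac_eval x (p l) \<noteq> 0) \<and> (\<Sum>l\<in>A. fps_of_poly (p l) * y l) = 0"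
  using assms(3-)
proof (induction "degree (p t)" arbitrary: p rule: less_induct)
  case less
  show ?case
  proof (cases "\<forall>l\<in>A. ac_eval x (p l) = 0")
    case True
    then have "\<forall>l\<in>A. \<exists>r. p l = m * r" by (simp add: dvd_def flip: m(2))
    then obtain r where r: "\<And>l. l \<in> A \<Longrightarrow> p l = m * r l" by metis
    have "degree m > 0" by (rule minimal_polynomial_degree_pos[OF m])
    moreover have "r t \<noteq> 0" using less.prems r by auto
    ultimately have "degree (r t) < degree (p t)"
      using r[OF less.prems(1)] m(1) by (simp add: degree_mult_eq)
    moreover have "fps_of_poly m * (\<Sum>l\<in>A. fps_of_poly (r l) * y l) = (\<Sum>l\<in>A. fps_of_poly (p l) * y l)"
      unfolding sum_distrib_left by (rule sum.cong) (auto simp: r fps_of_poly_mult mult.assoc)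
    then have "(\<Sum>l\<in>A. fps_of_poly (r l) * y l) = 0"
      using less.prems(3) m(1) by (simp add: fps_of_poly_eq_iff[of _ 0, simplified])
    ultimately show ?thesis using less.hyps less.prems(1) \<open>r t \<noteq> 0\<close> by blast
  qed (use less.prems in blast)
qed

text \<open>In characteristic 0 the non-constant \<open>m\<close> has a nonzero derivative of
  smaller degree, which \<open>m\<close> cannot divide.\<close>

lemma minimal_polynomial_simple_root:
  fixes m :: "'a::field_char_0 poly"
  assumes m: "m \<noteq> 0" "\<And>q. m dvd q \<longleftrightarrow> ac_eval x q = 0"
  shows "ac_eval x (pderiv m) \<noteq> 0"
proof
  assume "ac_eval x (pderiv m) = 0"
  then have "m dvd pderiv m" by (rule iffD2[OF m(2)])
  have "pderiv m = 0"
  proof (rule ccontr)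
    assume "pderiv m \<noteq> 0"
    then have "degree m \<le> degree (pderiv m)" "degree m \<noteq> 0"
      using \<open>m dvd pderiv m\<close> \<open>pderiv m \<noteq> 0\<close> by (auto intro: dvd_imp_degree_le simp: pderiv_eq_0_iff)
    then show False by (simp add: degree_pderiv)
  qed
  then have "is_unit m"
    using m(1) by (auto elim!: degree_eq_zeroE simp: pderiv_eq_0_iff is_unit_const_poly_iff dvd_field_iff)
  then show False using m(2)[of 1] by simp
qed

text \<open>Characteristic zero enters here: it keeps the dilation unramified at \<open>x\<close>.\<close>

lemma dilate_minimal_polynomial:
  fixes m :: "'a::field_char_0 poly"
  assumes m: "m \<noteq> 0" "\<And>q. m dvd q \<longleftrightarrow> ac_eval x q = 0"
    and "x \<noteq> 0" "q > 0" "x ^ q = x"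
  obtains w where "dilate_poly q m = m * w" "ac_eval x w \<noteq> 0"
proof -
  have m0: "ac_eval x m = 0" using m(2)[of m] by simp
  then have "m dvd dilate_poly q m" using assms(5) by (simp add: m(2))
  then obtain w where w: "dilate_poly q m = m * w" by auto
  \<comment> \<open>Comparing the chain rule with the product rule at \<open>x\<close> and
    cancelling the derivative of \<open>m\<close> gives \<open>q x^(q - 1)\<close> as the value of
    \<open>w\<close>.\<close>
  have "pderiv (dilate_poly q m) = dilate_poly q (pderiv m) * smult (of_nat q) (monom 1 (q - 1))"
    by (simp add: dilate_poly_def pderiv_pcompose pderiv_monom smult_monom)
  then have "ac_eval x (pderiv (dilate_poly q m)) = ac_eval x (pderiv m) * (of_nat q * x ^ (q - 1))"
    using assms(5) by simp
  moreover have "ac_eval x (pderiv (m * w)) = ac_eval x (pderiv m) * ac_eval x w"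
    by (simp add: pderiv_mult m0)
  ultimately have "ac_eval x (pderiv m) * (of_nat q * x ^ (q - 1)) = ac_eval x (pderiv m) * ac_eval x w"
    unfolding w by (rule trans[OF sym])
  then have "ac_eval x w = of_nat q * x ^ (q - 1)"
    using mult_left_cancel[OF minimal_polynomial_simple_root[OF m]] by metis
  with assms(3,4) have "ac_eval x w \<noteq> 0" by simp
  with w that show ?thesis by blast
qed

lemma factor_out_minimal_polynomial:
  fixes c :: "'a::field poly"
  assumes m: "m \<noteq> 0" "\<And>q. m dvd q \<longleftrightarrow> ac_eval x q = 0" and "c \<noteq> 0"
  obtains b c' where "c = m ^ b * c'" "ac_eval x c' \<noteq> 0"
proof -
  have "\<exists>b c'. c = m ^ b * c' \<and> ac_eval x c' \<noteq> 0"
    using assms(3)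
  proof (induction "degree c" arbitrary: c rule: less_induct)
    case less
    show ?case
    proof (cases "ac_eval x c = 0")
      case True
      then obtain r where r: "c = m * r" using m(2) by auto
      have "degree m > 0" by (rule minimal_polynomial_degree_pos[OF m])
      with r less.prems have "degree r < degree c" "r \<noteq> 0" by (auto simp: degree_mult_eq)
      then obtain b c' where "r = m ^ b * c'" "ac_eval x c' \<noteq> 0" using less.hyps by blast
      with r show ?thesis by (intro exI[of _ "Suc b"] exI[of _ c']) (simp add: mult.assoc)
    next
      case False
      then show ?thesis by (intro exI[of _ 0] exI[of _ c]) simp
    qed
  qed
  with that show ?thesis by blast
qed

text \<open>Regularity makes the chain of localized modules stabilize, while the root forces a drop
  at every multiple of \<open>p\<close>.\<close>

lemma not_k_regular_if_root_periodic:
  fixes f :: "'a::field_char_0 fps"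
  assumes "k \<ge> 2" "is_mahler k f" "x \<noteq> 0" "p > 0" "x ^ (k ^ p) = x"
    and root: "ac_eval x (mahler_denominator k f) = 0"
  shows "\<not> k_regular k f"
proof
  assume "k_regular k f"
  have "k > 0" using assms(1) by simp
  obtain c where c: "c \<noteq> 0"
    "\<And>e r. r < k ^ e \<Longrightarrow> fps_of_poly c * cartier (k ^ e) r f \<in> mahler_module k f 0"
    using k_regular_common_multiple[OF assms(2) \<open>k > 0\<close> \<open>k_regular k f\<close>] by blast
  obtain m where m: "m \<noteq> 0" "\<And>q. m dvd q \<longleftrightarrow> ac_eval x q = 0"
    using minimal_polynomial_exists[OF mahler_denominator_nonzero[OF assms(2)] root] by blast
  obtain b c' where c': "c = m ^ b * c'" "ac_eval x c' \<noteq> 0"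
    using factor_out_minimal_polynomial[OF m c(1)] by blast
  have period: "x ^ (k ^ (p * t)) = x" for t
    by (induction t) (simp_all add: power_add power_mult assms(5))
  \<comment> \<open>The localization of \<open>M_j\<close> at \<open>x\<close>, kept inside the
    power series.\<close>
  define L where "L = (\<lambda>j. {y. \<exists>u. ac_eval x u \<noteq> 0 \<and> fps_of_poly u * y \<in> mahler_module k f j})"
  have LI: "y \<in> L j" if "ac_eval x u \<noteq> 0" "fps_of_poly u * y \<in> mahler_module k f j" for u y j
    using that unfolding L_def by blast
  have add: "y + z \<in> L j" if yz: "y \<in> L j" "z \<in> L j" for y z j
  proof -
    obtain u u' where u: "ac_eval x u \<noteq> 0" "fps_of_poly u * y \<in> mahler_module k f j"
      "ac_eval x u' \<noteq> 0" "fps_of_poly u' * z \<in> mahler_module k f j"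
      using yz unfolding L_def by blast
    have "fps_of_poly (u * u') * (y + z) = fps_of_poly u' * (fps_of_poly u * y) + fps_of_poly u * (fps_of_poly u' * z)"
      by (simp add: fps_of_poly_mult algebra_simps)
    also have "\<dots> \<in> mahler_module k f j" by (intro mahler_module_add mahler_module_mult[OF u(2)] mahler_module_mult[OF u(4)])
    finally show ?thesis using u by (intro LI[of "u * u'"]) auto
  qed
  have mult: "fps_of_poly q * y \<in> L j" if y: "y \<in> L j" for q y j
  proof -
    obtain u where u: "ac_eval x u \<noteq> 0" "fps_of_poly u * y \<in> mahler_module k f j"
      using y unfolding L_def by blast
    have "fps_of_poly u * (fps_of_poly q * y) = fps_of_poly q * (fps_of_poly u * y)" by (simp add: mult_ac)
    also have "\<dots> \<in> mahler_module k f j" by (rule mahler_module_mult[OF u(2)])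
    finally show ?thesis using u(1) by (rule LI[rotated])
  qed
  have sat: "y \<in> L j" if u: "ac_eval x u \<noteq> 0" and y: "fps_of_poly u * y \<in> L j" for u y j
  proof -
    obtain v where "ac_eval x v \<noteq> 0" "fps_of_poly v * (fps_of_poly u * y) \<in> mahler_module k f j"
      using y unfolding L_def by blast
    with u show ?thesis by (intro LI[of "v * u"]) (auto simp: fps_of_poly_mult mult.assoc)
  qed
  have sub: "mahler_module k f j \<subseteq> L j" for j
    using LI[of 1] by auto
  have anti: "L j \<subseteq> L i" if "i \<le> j" for i j
    using mahler_module_antimono[OF that, of k f] unfolding L_def by blast
  have dil: "fps_of_poly (m ^ b) * dilate (k ^ i) f \<in> L j" for i j
  proof -
    \<comment> \<open>A multiple of the period that is at least \<open>i\<close> and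
      \<open>j\<close>. Then \<open>x ^ (k ^ E) = x\<close>, so \<open>m\<close> divides its own
      dilate exactly once and the dilate of \<open>c\<close> contains \<open>m\<close> exactly
      \<open>b\<close> times.\<close>
    define E where "E = p * (i + j)"
    have E: "i \<le> E" "j \<le> E" using assms(4) unfolding E_def by (cases p; simp)+
    obtain w where w: "dilate_poly (k ^ E) m = m * w" "ac_eval x w \<noteq> 0"
      using dilate_minimal_polynomial[OF m assms(3), of "k ^ E"] period[of "i + j"] \<open>k > 0\<close>
      unfolding E_def by auto
    define u where "u = w ^ b * dilate_poly (k ^ E) c'"
    have u: "ac_eval x u \<noteq> 0" using w(2) c'(2) period[of "i + j"] by (simp add: u_def E_def)
    have "fps_of_poly (dilate_poly (k ^ (E - i)) c) * f \<in> mahler_module k f (E - i)"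
      using \<open>k > 0\<close> c(2) by (rule dilate_poly_mult_in_mahler_module)
    from dilate_mahler_module[OF \<open>k > 0\<close> this, of i]
    have "fps_of_poly (dilate_poly (k ^ E) c) * dilate (k ^ i) f \<in> mahler_module k f E"
      using E(1) \<open>k > 0\<close>
      by (simp add: dilate_mult dilate_poly_dilate_poly flip: fps_of_poly_dilate_poly power_add)
    also have "dilate_poly (k ^ E) c = u * m ^ b"
      by (simp add: c'(1) dilate_poly_mult dilate_poly_power w(1) u_def power_mult_distrib mult_ac)
    finally have "fps_of_poly (m ^ b) * dilate (k ^ i) f \<in> L E"
      using u by (intro LI[of u]) (auto simp: fps_of_poly_mult mult.assoc)
    then show ?thesis using anti[OF E(2)] by blast
  qed
  have bound0: "fps_of_poly (m ^ b) * y \<in> L j" if "y \<in> mahler_module k f 0" for y j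
    using that
  proof induction
    case zero
    show ?case using sub[of j] mahler_module.zero[of k f j] by auto
  next
    case (step i y q)
    have "fps_of_poly (m ^ b) * (fps_of_poly q * dilate (k ^ i) f + y) =
      fps_of_poly q * (fps_of_poly (m ^ b) * dilate (k ^ i) f) + fps_of_poly (m ^ b) * y"
      by (simp add: algebra_simps)
    then show ?case using add[OF mult[OF dil] step.IH] by simp
  qed
  have bound: "fps_of_poly (m ^ b) * y \<in> L j" if y: "y \<in> L 0" for y j
  proof -
    obtain u where u: "ac_eval x u \<noteq> 0" "fps_of_poly u * y \<in> mahler_module k f 0"
      using y unfolding L_def by blast
    have "fps_of_poly u * (fps_of_poly (m ^ b) * y) \<in> L j"
      using bound0[OF u(2)] by (simp add: mult.left_commute)
    with u(1) show ?thesis by (rule sat)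
  qed
  obtain n where n: "\<And>y. y \<in> mahler_module k f 0 \<Longrightarrow>
    \<exists>s a. s \<noteq> 0 \<and> fps_of_poly s * y = (\<Sum>l<n. fps_of_poly (a l) * dilate (k ^ l) f)"
    using mahler_module_rational_rank[OF assms(2) \<open>k > 0\<close>] by blast
  have rank: "\<exists>q. (\<exists>l\<in>A. ac_eval x (q l) \<noteq> 0) \<and> (\<Sum>l\<in>A. fps_of_poly (q l) * y l) = 0"
    if A: "finite A" "card A > n" "y ` A \<subseteq> L 0" for A :: "nat set" and y
  proof -
    \<comment> \<open>Up to denominators each \<open>y l\<close> is a combination of
      \<open>n\<close> dilates of \<open>f\<close>, so more than \<open>n\<close> of them are
      dependent over \<open>K[z]\<close>.\<close>
    have "\<exists>s a. s \<noteq> 0 \<and> fps_of_poly s * y l = (\<Sum>i<n. fps_of_poly (a i) * dilate (k ^ i) f)"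
      if l: "l \<in> A" for l
    proof -
      obtain u where u: "ac_eval x u \<noteq> 0" "fps_of_poly u * y l \<in> mahler_module k f 0"
        using A(3) l unfolding L_def by blast
      obtain s a where sa: "s \<noteq> 0" "fps_of_poly s * (fps_of_poly u * y l) = (\<Sum>i<n. fps_of_poly (a i) * dilate (k ^ i) f)"
        using n[OF u(2)] by blast
      have "u \<noteq> 0" using u(1) by auto
      with sa show ?thesis
        by (intro exI[of _ "s * u"] exI[of _ a]) (simp add: fps_of_poly_mult mult.assoc)
    qed
    then obtain s a where sa: "\<And>l. l \<in> A \<Longrightarrow> s l \<noteq> 0"
      "\<And>l. l \<in> A \<Longrightarrow> fps_of_poly (s l) * y l = (\<Sum>i<n. fps_of_poly (a l i) * dilate (k ^ i) f)"
      by metis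
    obtain q where q: "\<exists>l\<in>A. q l \<noteq> 0" "\<forall>i<n. (\<Sum>l\<in>A. q l * a l i) = 0"
      using homogeneous_system_nontrivial_solution[OF A(1,2), of a] by blast
    obtain t where t: "t \<in> A" "q t \<noteq> 0" using q(1) by blast
    have "(\<Sum>l\<in>A. fps_of_poly (q l * s l) * y l) =
        (\<Sum>l\<in>A. \<Sum>i<n. fps_of_poly (q l * a l i) * dilate (k ^ i) f)"
      by (rule sum.cong) (auto simp: fps_of_poly_mult mult.assoc sa(2) sum_distrib_left)
    also have "\<dots> = (\<Sum>i<n. \<Sum>l\<in>A. fps_of_poly (q l * a l i) * dilate (k ^ i) f)"
      by (rule sum.swap)
    also have "\<dots> = (\<Sum>i<n. fps_of_poly (\<Sum>l\<in>A. q l * a l i) * dilate (k ^ i) f)"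
      by (simp add: fps_of_poly_sum sum_distrib_right)
    also have "\<dots> = 0" using q(2) by simp
    finally show ?thesis
      using t sa(1)[OF t(1)] by (intro relation_not_all_divisible[OF m, where p = "\<lambda>l. q l * s l" and t = t]) auto
  qed
  have "finite {j. L (Suc j) \<noteq> L j}"
    using m(2)
  proof (rule descending_chain_stabilizes[where L = L])
    show "0 \<in> L j" for j using sub[of j] mahler_module.zero[of k f j] by auto
  qed (fact add mult anti sat bound rank)+
  \<comment> \<open>Without a drop at \<open>j = p t\<close>, some multiplier \<open>u\<close>
    nonzero at \<open>x\<close> would take \<open>f(z^(k^j))\<close> into \<open>M_(j+1)\<close>;
    but \<open>d(z^(k^j))\<close> divides \<open>u\<close> and vanishes at \<open>x\<close>.\<close>
  moreover have "range (\<lambda>t. p * t) \<subseteq> {j. L (Suc j) \<noteq> L j}"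
  proof clarify
    fix t assume eq: "L (Suc (p * t)) = L (p * t)"
    define j where "j = p * t"
    have "dilate (k ^ j) f \<in> L j" using sub dilate_in_mahler_module by blast
    then have "dilate (k ^ j) f \<in> L (Suc j)" using eq by (simp add: j_def)
    then obtain u where u: "ac_eval x u \<noteq> 0" "fps_of_poly u * dilate (k ^ j) f \<in> mahler_module k f (Suc j)"
      unfolding L_def by blast
    from u(2) have "dilate_poly (k ^ j) (mahler_denominator k f) dvd u"
      by (rule dilate_mahler_denominator_dvd[OF assms(2) \<open>k > 0\<close>])
    moreover have "ac_eval x (dilate_poly (k ^ j) (mahler_denominator k f)) = 0"
      using root period[of t] by (simp add: j_def)
    ultimately show False using u(1) by auto
  qed
  ultimately have "finite (range (\<lambda>t. p * t))" using finite_subset by blast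
  moreover have "inj (\<lambda>t. p * t)" using assms(4) by (auto intro: injI)
  ultimately show False using finite_imageD infinite_UNIV_nat by blast
qed

text \<open>All \<open>x ^ (k ^ e)\<close> with \<open>e \<ge> 1\<close> are roots of the common
  denominator \<open>c\<close>, so two of them coincide.\<close>

lemma k_regular_roots_eventually_periodic:
  fixes f :: "'a::field fps"
  assumes "is_mahler k f" "k > 0" "k_regular k f"
    and root: "ac_eval x (mahler_denominator k f) = 0"
  obtains e p where "p > 0" "x ^ (k ^ (e + p)) = x ^ (k ^ e)"
proof -
  obtain c where c: "c \<noteq> 0"
    "\<And>e r. r < k ^ e \<Longrightarrow> fps_of_poly c * cartier (k ^ e) r f \<in> mahler_module k f 0"
    using k_regular_common_multiple[OF assms(1-3)] by blast
  have "ac_eval (x ^ (k ^ Suc e)) c = 0" for e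
  proof -
    have "fps_of_poly (dilate_poly (k ^ Suc e) c) * f \<in> mahler_module k f (Suc e)"
      using assms(2) c(2) by (rule dilate_poly_mult_in_mahler_module)
    also have "mahler_module k f (Suc e) \<subseteq> mahler_module k f (Suc 0)"
      by (rule mahler_module_antimono) simp
    finally have "mahler_denominator k f dvd dilate_poly (k ^ Suc e) c"
      by (simp only: mahler_denominator_dvd_iff[OF assms(1)])
    then obtain r where "dilate_poly (k ^ Suc e) c = mahler_denominator k f * r" ..
    from arg_cong[OF this, of "ac_eval x"] root show ?thesis by simp
  qed
  then have "range (\<lambda>e. x ^ (k ^ Suc e)) \<subseteq> {y. ac_eval y c = 0}" by auto
  then have "finite (range (\<lambda>e. x ^ (k ^ Suc e)))" using finite_ac_roots[OF c(1)] finite_subset by blast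
  then have "\<not> inj (\<lambda>e. x ^ (k ^ Suc e))" using finite_imageD infinite_UNIV_nat by blast
  then obtain e e' where "x ^ (k ^ Suc e) = x ^ (k ^ Suc e')" "e < e'"
    unfolding inj_def by (metis linorder_neqE_nat)
  then show ?thesis using that[of "e' - e" "Suc e"] by simp
qed

lemma k_regular_roots:
  fixes f :: "'a::field_char_0 fps"
  assumes "k \<ge> 2" "is_mahler k f" "k_regular k f" "x \<noteq> 0"
    and root: "ac_eval x (mahler_denominator k f) = 0"
  shows "is_root_of_unity x \<and> \<not> coprime (root_of_unity_order x) k"
proof
  have "k > 0" using assms(1) by simp
  obtain e p where ep: "p > 0" "x ^ (k ^ (e + p)) = x ^ (k ^ e)"
    using k_regular_roots_eventually_periodic[OF assms(2) \<open>k > 0\<close> assms(3) root] by blast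
  have "1 < k ^ p" using assms(1) ep(1) by (intro one_less_power) auto
  then have kp: "k ^ p = Suc (k ^ p - 1)" by simp
  \<comment> \<open>Cancelling \<open>x ^ (k ^ e)\<close> leaves the exponent
    \<open>k ^ e * (k ^ p - 1)\<close>, positive because \<open>k ^ p > 1\<close>.\<close>
  then have "k ^ (e + p) = k ^ e * (k ^ p - 1) + k ^ e" by (metis mult_Suc_right power_add add.commute)
  with ep(2) assms(4) have one: "x ^ (k ^ e * (k ^ p - 1)) = 1" by (simp add: power_add)
  then show rou: "is_root_of_unity x"
    unfolding is_root_of_unity_def using \<open>1 < k ^ p\<close> \<open>k > 0\<close> by (intro exI[of _ "k ^ e * (k ^ p - 1)"]) simp
  show "\<not> coprime (root_of_unity_order x) k"
  proof
    \<comment> \<open>An order coprime to \<open>k\<close> divides \<open>k ^ p - 1\<close>, so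
      \<open>x\<close> is periodic and not only eventually periodic.\<close>
    assume "coprime (root_of_unity_order x) k"
    then have "coprime (root_of_unity_order x) (k ^ e)" by simp
    moreover have "root_of_unity_order x dvd k ^ e * (k ^ p - 1)"
      using one by (simp add: power_eq_1_iff_order_dvd(1)[OF rou])
    ultimately have "root_of_unity_order x dvd k ^ p - 1" by (simp add: coprime_dvd_mult_right_iff)
    then have "x ^ (k ^ p - 1) = 1" by (simp add: power_eq_1_iff_order_dvd(1)[OF rou])
    then have "x ^ (k ^ p) = x" by (subst kp) simp
    with not_k_regular_if_root_periodic[OF assms(1,2,4) ep(1) _ root] assms(3) show False by blast
  qed
qed

theorem theorem10p4:
  fixes k :: nat and f :: "'a::field_char_0 fps"
  assumes "k \<ge> 2" and "is_mahler k f"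
  shows "k_regular k f \<longleftrightarrow>
    (\<forall>x :: 'a alg_closure. x \<noteq> 0 \<longrightarrow> poly (map_poly to_ac (mahler_denominator k f)) x = 0 \<longrightarrow>
       is_root_of_unity x \<and> \<not> coprime (root_of_unity_order x) k)"
  using k_regular_roots[OF assms] k_regular_if_roots[OF assms]
  unfolding ac_eval_def by blast

end
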